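(* Consider lifts of universal effective kinematical Klein pairs into universal projectable ambient triplets, up to isomorphism of triplets. (a) Each of the following ten non-galilean kinematical Klein pairs $(\bar{\mathfrak g},\bar{\mathfrak h})$, $\bar{\mathfrak h}=\mathbf K\oplus\mathbf J$, admits a unique lift, namely the trivial one $(\bar{\mathfrak g}\oplus\mathbb R M,\ \bar{\mathfrak h},\ \mathbb R M)$ with $M$ central: - (carrollian) $[\mathbf K,\mathbf P]=H$; or $[\mathbf K,\mathbf P]=H$, $[H,\mathbf P]=\eta\mathbf K$, $[\mathbf P,\mathbf P]=\eta\mathbf J$ with $\eta=\pm1$; or $[\mathbf K,\mathbf P]=H+\mathbf J$, $[H,\mathbf P]=-\mathbf P$, $[\mathbf K,H]=-\mathbf K$; - (riemannian) $[\mathbf K,\mathbf K]=-\mathbf J$, $[\mathbf K,\mathbf P]=H$, $[\mathbf K,H]=-\mathbf P$, $[H,\mathbf P]=\eta\mathbf K$, $[\mathbf P,\mathbf P]=\eta\mathbf J$ with $\eta\in\{0,1,-1\}$; - (lorentzian) $[\mathbf K,\mathbf K]=\mathbf J$, $[\mathbf K,\mathbf P]=H$, $[\mathbf K,H]=\mathbf P$, $[H,\mathbf P]=\eta\mathbf K$, $[\mathbf P,\mathbf P]=\eta\mathbf J$ with $\eta\in\{0,1,-1\}$. (b) Each galilean kinematical Klein pair with commutators $[\mathbf K,H]=\mathbf P$, $[H,\mathbf P]=\epsilon\mathbf K+\omega\mathbf P$, where $(\epsilon,\omega)\in\{(0,0),(0,1),(1,0),(-1,0)\}\cup\{(1,\alpha),(-1,\alpha):\alpha>0\}$,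 admits lifts into two distinct classes, and up to isomorphism these are exactly the following pairwise non-isomorphic ones: - a unique bargmannian lift, with additional commutators $[\mathbf K,\mathbf P]=M$, $[H,M]=\omega M$; - $\mathsf G$-ambient lifts, with additional commutator $[H,M]=\lambda M$, where: $\lambda\in\{0,1\}$ if $(\epsilon,\omega)=(0,0)$; $\lambda\ge0$ if $(\epsilon,\omega)=(\pm1,0)$; $\lambda\in\mathbb R$ if $\omega\neq0$.
   Context: All Lie algebras are real and finite-dimensional. A Klein pair is a pair $(\mathfrak g,\mathfrak h)$ of a Lie algebra and a Lie subalgebra; it is effective if $\mathfrak h$ contains no non-zero ideal of $\mathfrak g$. Let $J_{ij}=-J_{ji}$ ($1\le i,j\le d$) span $\mathbf J\simeq\mathfrak{so}(d)$ with $[J_{ij},J_{kl}]=\delta_{jk}J_{il}-\delta_{jl}J_{ik}+\delta_{il}J_{jk}-\delta_{ik}J_{jl}$. A vector module $\mathbf V=\mathrm{Span}\{V_i\}$ satisfies $[J_{ij},V_k]=-\delta_{ik}V_j+\delta_{jk}V_i$, and a scalar $S$ satisfies $[J_{ij},S]=0$. A kinematical Klein pair is $(\bar{\mathfrak g},\bar{\mathfrak h})$ with $\bar{\mathfrak g}=\mathrm{Span}(H)\oplus\mathbf P\oplus\mathbf K\oplus\mathbf J$ ($H$ scalar, $\mathbf P,\mathbf K$ vector modules) and $\bar{\mathfrak h}=\mathbf K\oplus\mathbf J$. An ambient aristotelian Klein pair is $(\mathfrak g,\mathfrak h)$ with $\mathfrak g=\mathrm{Span}(M)\oplus\mathrm{Span}(H)\oplus\mathbf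 P\oplus\mathbf K\oplus\mathbf J$ ($M,H$ scalars, $\mathbf P,\mathbf K$ vector modules) and $\mathfrak h=\mathbf K\oplus\mathbf J$. A projectable ambient triplet $(\mathfrak g,\mathfrak h,\mathfrak i)$ is an effective ambient aristotelian Klein pair with a one-dimensional ideal $\mathfrak i$ spanned by a scalar (chosen as $\mathfrak i=\mathrm{Span}(M)$) such that the kinematical Klein pair $(\mathfrak g/\mathfrak i,\mathfrak h)$ is effective. Isomorphisms of Klein pairs (resp. triplets) are Lie algebra isomorphisms mapping $\mathfrak h_1$ onto $\mathfrak h_2$ (resp. also $\mathfrak i_1$ onto $\mathfrak i_2$) and preserving the $\mathfrak{so}(d)$-decomposition ($\mathbf J$ to $\mathbf J$, scalars to scalars, sum of vector modules to sum of vector modules). A kinematical Klein pair admits a lift into the triplet $(\mathfrak g,\mathfrak h,\mathfrak i)$ if it is isomorphic to $(\mathfrak g/\mathfrak i,\mathfrak h)$. Universal means: a sequence indexed by the integer $d\ge1$, with the commutators not involving $\mathbf J$ on the left given by real coefficients independent of $d$ (scalar-scalar brackets are combinations of scalars; the bracket of a scalar with $V_i$ is a combination of $K_i,P_i$; $[K_i,P_j]=\delta_{ij}\cdot(\text{scalar})+cJ_{ij}$; $[K_i,K_j]=eJ_{ij}$; $[P_i,P_j]=fJ_{ij}$). Universal objects are isomorphic if they are so for every $d$. Shorthand: $[\mathbf K,H]=\mathbf P$ means $[K_i,H]=P_i$; $[\mathbf K,\mathbf P]=H+\mathbf J$ means $[K_i,P_j]=\delta_{ij}H+J_{ij}$;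 $[\mathbf K,\mathbf K]=\mathbf J$ means $[K_i,K_j]=J_{ij}$; commutators not listed (and not involving $\mathbf J$) vanish. Bargmannian and $\mathsf G$-ambient: with $\mathfrak h$ acting on $\mathfrak g/\mathfrak h\simeq\mathrm{Span}\{M,H,P_i\}$ by the induced adjoint action, the triplet is bargmannian (resp. $\mathsf G$-ambient) if $\boldsymbol\xi=M$, $\boldsymbol\psi=-H^*$, $\boldsymbol\gamma=\sum_iP_i^*\otimes P_i^*$ (on $\ker\boldsymbol\psi$) and $\boldsymbol g=-M^*\otimes H^*-H^*\otimes M^*+\sum_iP_i^*\otimes P_i^*$ (resp. $\boldsymbol A=M^*$) are $\mathfrak h$-invariant. *)

theory Defs
  imports "HOL-Algebra.Module" "HOL-Algebra.QuotRing" "HOL-Algebra.Algebraic_Closure_Type"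
begin

section \<open>Lie algebras, Klein pairs and their quotients\<close>

abbreviation real_ring :: "real ring" where
  "real_ring \<equiv> ring_of_type_algebra"

text \<open>
  A real Lie algebra is a module record over the reals whose \<open>mult\<close> field is the bracket;
  the field \<open>one\<close> of the record is not used.
\<close>

locale lie_algebra = module real_ring L
  for L :: "(real, 'a) module" +
  assumes bracket_closed:
      "\<lbrakk>x \<in> carrier L; y \<in> carrier L\<rbrakk> \<Longrightarrow> x \<otimes>\<^bsub>L\<^esub> y \<in> carrier L"
    and bracket_add_left:
      "\<lbrakk>x \<in> carrier L; y \<in> carrier L; z \<in> carrier L\<rbrakk>
        \<Longrightarrow> (x \<oplus>\<^bsub>L\<^esub> y) \<otimes>\<^bsub>L\<^esub> z = (x \<otimes>\<^bsub>L\<^esub> z) \<oplus>\<^bsub>L\<^esub> (y \<otimes>\<^bsub>L\<^esub> z)"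
    and bracket_add_right:
      "\<lbrakk>x \<in> carrier L; y \<in> carrier L; z \<in> carrier L\<rbrakk>
        \<Longrightarrow> z \<otimes>\<^bsub>L\<^esub> (x \<oplus>\<^bsub>L\<^esub> y) = (z \<otimes>\<^bsub>L\<^esub> x) \<oplus>\<^bsub>L\<^esub> (z \<otimes>\<^bsub>L\<^esub> y)"
    and bracket_smult_left:
      "\<lbrakk>x \<in> carrier L; y \<in> carrier L\<rbrakk>
        \<Longrightarrow> (r \<odot>\<^bsub>L\<^esub> x) \<otimes>\<^bsub>L\<^esub> y = r \<odot>\<^bsub>L\<^esub> (x \<otimes>\<^bsub>L\<^esub> y)"
    and bracket_smult_right:
      "\<lbrakk>x \<in> carrier L; y \<in> carrier L\<rbrakk>
        \<Longrightarrow> x \<otimes>\<^bsub>L\<^esub> (r \<odot>\<^bsub>L\<^esub> y) = r \<odot>\<^bsub>L\<^esub> (x \<otimes>\<^bsub>L\<^esub> y)"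
    and bracket_alternating:
      "x \<in> carrier L \<Longrightarrow> x \<otimes>\<^bsub>L\<^esub> x = \<zero>\<^bsub>L\<^esub>"
    and bracket_jacobi:
      "\<lbrakk>x \<in> carrier L; y \<in> carrier L; z \<in> carrier L\<rbrakk>
        \<Longrightarrow> (x \<otimes>\<^bsub>L\<^esub> (y \<otimes>\<^bsub>L\<^esub> z)) \<oplus>\<^bsub>L\<^esub> (y \<otimes>\<^bsub>L\<^esub> (z \<otimes>\<^bsub>L\<^esub> x)) \<oplus>\<^bsub>L\<^esub> (z \<otimes>\<^bsub>L\<^esub> (x \<otimes>\<^bsub>L\<^esub> y)) = \<zero>\<^bsub>L\<^esub>"
    and finite_dimensional:
      "\<exists>B. finite B \<and> B \<subseteq> carrier L \<and>
        (\<forall>N. submodule N real_ring L \<longrightarrow> B \<subseteq> N \<longrightarrow> N = carrier L)"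

definition lie_subalgebra :: "'a set \<Rightarrow> (real, 'a) module \<Rightarrow> bool" where
  "lie_subalgebra h L \<longleftrightarrow>
     submodule h real_ring L \<and> (\<forall>x\<in>h. \<forall>y\<in>h. x \<otimes>\<^bsub>L\<^esub> y \<in> h)"

definition lie_ideal :: "'a set \<Rightarrow> (real, 'a) module \<Rightarrow> bool" where
  "lie_ideal I L \<longleftrightarrow>
     submodule I real_ring L \<and> (\<forall>x\<in>carrier L. \<forall>y\<in>I. x \<otimes>\<^bsub>L\<^esub> y \<in> I)"

definition lie_iso :: "(real, 'a) module \<Rightarrow> (real, 'b) module \<Rightarrow> ('a \<Rightarrow> 'b) set" where
  "lie_iso L L' =
     {f. f \<in> iso (add_monoid L) (add_monoid L') \<and>
         (\<forall>r. \<forall>x\<in>carrier L. f (r \<odot>\<^bsub>L\<^esub> x) = r \<odot>\<^bsub>L'\<^esub> f x) \<and>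
         (\<forall>x\<in>carrier L. \<forall>y\<in>carrier L. f (x \<otimes>\<^bsub>L\<^esub> y) = f x \<otimes>\<^bsub>L'\<^esub> f y)}"

text \<open>
  The library's factor construction \<open>Quot\<close> supplies cosets, their sum and the induced
  product (here: bracket); only the scalar multiplication is added.
\<close>

definition lie_quotient :: "(real, 'a) module \<Rightarrow> 'a set \<Rightarrow> (real, 'a set) module" where
  "lie_quotient L I =
     ring.extend (L Quot I) (module.fields (\<lambda>r A. \<Union>x\<in>A. I +>\<^bsub>L\<^esub> (r \<odot>\<^bsub>L\<^esub> x)))"

text \<open>
  A pair \<open>(\<gg>, \<hh>)\<close> together with its \<open>\<ss>\<oo>(d)\<close>-decomposition: the rotations \<open>J\<close>, the span of
  the scalars, and the sum \<open>P \<oplus> K\<close> of the vector modules.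
\<close>

record 'a klein =
  lie :: "(real, 'a) module"
  isotropy :: "'a set"
  rotations :: "'a set"
  scalars :: "'a set"
  vectors :: "'a set"

definition klein_pair :: "'a klein \<Rightarrow> bool" where
  "klein_pair A \<longleftrightarrow> lie_algebra (lie A) \<and> lie_subalgebra (isotropy A) (lie A)"

definition effective :: "'a klein \<Rightarrow> bool" where
  "effective A \<longleftrightarrow>
     (\<forall>I. lie_ideal I (lie A) \<and> I \<subseteq> isotropy A \<longrightarrow> I = {\<zero>\<^bsub>lie A\<^esub>})"

definition klein_iso :: "'a klein \<Rightarrow> 'b klein \<Rightarrow> ('a \<Rightarrow> 'b) set" where
  "klein_iso A B =
     {f \<in> lie_iso (lie A) (lie B).
        f ` isotropy A = isotropy B \<and> f ` rotations A = rotations B \<and>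
        f ` scalars A = scalars B \<and> f ` vectors A = vectors B}"

definition klein_isomorphic :: "'a klein \<Rightarrow> 'b klein \<Rightarrow> bool" where
  "klein_isomorphic A B \<longleftrightarrow> klein_iso A B \<noteq> {}"

definition triplet_isomorphic :: "'a klein \<times> 'a set \<Rightarrow> 'b klein \<times> 'b set \<Rightarrow> bool" where
  "triplet_isomorphic T T' \<longleftrightarrow> (\<exists>f \<in> klein_iso (fst T) (fst T'). f ` snd T = snd T')"

definition klein_quotient :: "'a klein \<Rightarrow> 'a set \<Rightarrow> 'a set klein" where
  "klein_quotient A I =
     (let q = (\<lambda>x. I +>\<^bsub>lie A\<^esub> x) in
      \<lparr>lie = lie_quotient (lie A) I,
       isotropy = q ` isotropy A,
       rotations = q ` rotations A,
       scalars = q ` scalars A,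
       vectors = q ` vectors A\<rparr>)"

section \<open>Universal commutators\<close>

text \<open>
  The field \<open>XY_Z\<close> is the coefficient of \<open>Z\<close> in \<open>[X, Y]\<close>, where the bracket of a scalar \<open>S\<close>
  with a vector module is \<open>[S, V\<^sub>i] = a P\<^sub>i + b K\<^sub>i\<close> (respectively \<open>[V\<^sub>i, S]\<close>),
  \<open>[K\<^sub>i, P\<^sub>j] = \<delta>\<^sub>i\<^sub>j (a M + b H) + c J\<^sub>i\<^sub>j\<close>, \<open>[K\<^sub>i, K\<^sub>j] = e J\<^sub>i\<^sub>j\<close> and \<open>[P\<^sub>i, P\<^sub>j] = f J\<^sub>i\<^sub>j\<close>.
\<close>

record kin_coeffs =
  KH_P :: real
  KH_K :: real
  HP_P :: real
  HP_K :: real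
  KP_H :: real
  KP_J :: real
  KK_J :: real
  PP_J :: real

record amb_coeffs = kin_coeffs +
  KP_M :: real
  HM_M :: real
  HM_H :: real
  MP_P :: real
  MP_K :: real
  MK_P :: real
  MK_K :: real

text \<open>
  Coordinates with respect to \<open>M, H, P\<^sub>i, K\<^sub>i, J\<^sub>i\<^sub>j\<close>, the indices running over \<open>0, \<dots>, d - 1\<close>.
  The rotation part \<open>\<Sum>\<^sub>i\<^sub><\<^sub>j a\<^sub>i\<^sub>j J\<^sub>i\<^sub>j\<close> is stored as the skew matrix \<open>a\<close>, so that \<open>J\<^sub>i\<^sub>j\<close> is
  the matrix \<open>E\<^sub>i\<^sub>j - E\<^sub>j\<^sub>i\<close>, acting on \<open>V\<^sub>k\<close> as on the \<open>k\<close>-th basis vector. The kinematical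
  algebras use the same coordinates with vanishing \<open>M\<close>-component.
\<close>

record coords =
  mass :: real
  time :: real
  mom :: "nat \<Rightarrow> real"
  boost :: "nat \<Rightarrow> real"
  rot :: "nat \<Rightarrow> nat \<Rightarrow> real"

definition czero :: coords where
  "czero = \<lparr>mass = 0, time = 0, mom = (\<lambda>_. 0), boost = (\<lambda>_. 0), rot = (\<lambda>_ _. 0)\<rparr>"

definition cadd :: "coords \<Rightarrow> coords \<Rightarrow> coords" where
  "cadd x y =
     \<lparr>mass = mass x + mass y, time = time x + time y,
      mom = (\<lambda>i. mom x i + mom y i), boost = (\<lambda>i. boost x i + boost y i),
      rot = (\<lambda>i j. rot x i j + rot y i j)\<rparr>"

definition cscale :: "real \<Rightarrow> coords \<Rightarrow> coords" where
  "cscale r x =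
     \<lparr>mass = r * mass x, time = r * time x,
      mom = (\<lambda>i. r * mom x i), boost = (\<lambda>i. r * boost x i),
      rot = (\<lambda>i j. r * rot x i j)\<rparr>"

definition amb_space :: "nat \<Rightarrow> coords set" where
  "amb_space d =
     {x. (\<forall>i\<ge>d. mom x i = 0 \<and> boost x i = 0) \<and>
         (\<forall>i j. rot x i j = - rot x j i) \<and>
         (\<forall>i j. i \<ge> d \<or> j \<ge> d \<longrightarrow> rot x i j = 0)}"

definition kin_space :: "nat \<Rightarrow> coords set" where
  "kin_space d = {x \<in> amb_space d. mass x = 0}"

definition dot :: "nat \<Rightarrow> (nat \<Rightarrow> real) \<Rightarrow> (nat \<Rightarrow> real) \<Rightarrow> real" where
  "dot d u v = (\<Sum>i<d. u i * v i)"

definition wedge :: "(nat \<Rightarrow> real) \<Rightarrow> (nat \<Rightarrow> real) \<Rightarrow> nat \<Rightarrow> nat \<Rightarrow> real" where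
  "wedge u v i j = u i * v j - u j * v i"

definition matvec :: "nat \<Rightarrow> (nat \<Rightarrow> nat \<Rightarrow> real) \<Rightarrow> (nat \<Rightarrow> real) \<Rightarrow> nat \<Rightarrow> real" where
  "matvec d a v i = (\<Sum>j<d. a i j * v j)"

definition matcomm ::
  "nat \<Rightarrow> (nat \<Rightarrow> nat \<Rightarrow> real) \<Rightarrow> (nat \<Rightarrow> nat \<Rightarrow> real) \<Rightarrow> nat \<Rightarrow> nat \<Rightarrow> real" where
  "matcomm d a b i j = (\<Sum>l<d. a i l * b l j - b i l * a l j)"

text \<open>
  The bilinear alternating extension of the universal commutators; on generators it is
  computed in \<open>kin_commutators\<close>, \<open>amb_commutators\<close> and \<open>rotation_commutators\<close> below.
\<close>

definition kin_bracket :: "'z kin_coeffs_scheme \<Rightarrow> nat \<Rightarrow> coords \<Rightarrow> coords \<Rightarrow> coords" where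
  "kin_bracket c d x y =
     \<lparr>mass = 0,
      time = KP_H c * (dot d (boost x) (mom y) - dot d (boost y) (mom x)),
      mom = (\<lambda>i. matvec d (rot x) (mom y) i - matvec d (rot y) (mom x) i
                 + KH_P c * (boost x i * time y - boost y i * time x)
                 + HP_P c * (time x * mom y i - time y * mom x i)),
      boost = (\<lambda>i. matvec d (rot x) (boost y) i - matvec d (rot y) (boost x) i
                 + KH_K c * (boost x i * time y - boost y i * time x)
                 + HP_K c * (time x * mom y i - time y * mom x i)),
      rot = (\<lambda>i j. matcomm d (rot x) (rot y) i j
                 + KP_J c * (wedge (boost x) (mom y) i j - wedge (boost y) (mom x) i j)
                 + KK_J c * wedge (boost x) (boost y) i j
                 + PP_J c * wedge (mom x) (mom y) i j)\<rparr>"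

definition amb_bracket :: "amb_coeffs \<Rightarrow> nat \<Rightarrow> coords \<Rightarrow> coords \<Rightarrow> coords" where
  "amb_bracket c d x y =
     cadd (kin_bracket c d x y)
      \<lparr>mass = KP_M c * (dot d (boost x) (mom y) - dot d (boost y) (mom x))
              + HM_M c * (time x * mass y - time y * mass x),
       time = HM_H c * (time x * mass y - time y * mass x),
       mom = (\<lambda>i. MP_P c * (mass x * mom y i - mass y * mom x i)
                  + MK_P c * (mass x * boost y i - mass y * boost x i)),
       boost = (\<lambda>i. MP_K c * (mass x * mom y i - mass y * mom x i)
                  + MK_K c * (mass x * boost y i - mass y * boost x i)),
       rot = (\<lambda>_ _. 0)\<rparr>"

definition genM :: coords where "genM = czero\<lparr>mass := 1\<rparr>"
definition genH :: coords where "genH = czero\<lparr>time := 1\<rparr>"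
definition genP :: "nat \<Rightarrow> coords" where "genP i = czero\<lparr>mom := (\<lambda>a. of_bool (a = i))\<rparr>"
definition genK :: "nat \<Rightarrow> coords" where "genK i = czero\<lparr>boost := (\<lambda>a. of_bool (a = i))\<rparr>"
definition genJ :: "nat \<Rightarrow> nat \<Rightarrow> coords" where
  "genJ i j = czero\<lparr>rot := (\<lambda>a b. of_bool (a = i \<and> b = j) - of_bool (a = j \<and> b = i))\<rparr>"

lemma dot_unit:
  assumes "i < d"
  shows "dot d (\<lambda>a. of_bool (a = i)) v = v i"
proof -
  have "dot d (\<lambda>a. of_bool (a = i)) v = (\<Sum>a<d. if a = i then v i else 0)"
    unfolding dot_def by (rule sum.cong) auto
  with assms show ?thesis by simp
qed

lemma matvec_unit:
  assumes "i < d"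
  shows "matvec d m (\<lambda>a. of_bool (a = i)) = (\<lambda>b. m b i)"
proof
  fix b
  have "matvec d m (\<lambda>a. of_bool (a = i)) b = (\<Sum>a<d. if a = i then m b i else 0)"
    unfolding matvec_def by (rule sum.cong) auto
  with assms show "matvec d m (\<lambda>a. of_bool (a = i)) b = m b i" by simp
qed

lemma sum_matrix_units:
  fixes d :: nat
  assumes "j < d"
  shows "(\<Sum>l<d. of_bool (a = i \<and> l = j) * of_bool (l = k \<and> b = m)) =
         (of_bool (a = i \<and> b = m \<and> j = k) :: real)"
proof -
  have "(\<Sum>l<d. of_bool (a = i \<and> l = j) * of_bool (l = k \<and> b = m)) =
        (\<Sum>l<d. if l = j then of_bool (a = i \<and> b = m \<and> j = k) else (0::real))"
    by (rule sum.cong) auto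
  then show ?thesis using assms by simp
qed

definition matunit :: "nat \<Rightarrow> nat \<Rightarrow> nat \<Rightarrow> nat \<Rightarrow> real" where
  "matunit i j a b = of_bool (a = i \<and> b = j)"

lemma sum_matunit:
  assumes "j < d"
  shows "(\<Sum>l<d. matunit i j a l * matunit k m l b) = of_bool (j = k) * matunit i m a b"
  using sum_matrix_units[OF assms, of a i k b m] by (auto simp: matunit_def)

lemma rot_genJ: "rot (genJ i j) = (\<lambda>a b. matunit i j a b - matunit j i a b)"
  by (simp add: genJ_def matunit_def fun_eq_iff)

lemma matcomm_genJ:
  assumes "i < d" "j < d" "k < d" "l < d"
  shows "matcomm d (rot (genJ i j)) (rot (genJ k l)) a b =
           of_bool (j = k) * rot (genJ i l) a b - of_bool (j = l) * rot (genJ i k) a b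
           + of_bool (i = l) * rot (genJ j k) a b - of_bool (i = k) * rot (genJ j l) a b"
  using assms
  by (simp add: matcomm_def rot_genJ left_diff_distrib right_diff_distrib sum.distrib
      sum_subtractf sum_matunit eq_commute[of l] eq_commute[of k])

lemma zero_simps [simp]:
  "dot d (\<lambda>_. 0) v = 0" "dot d v (\<lambda>_. 0) = 0"
  "matvec d m (\<lambda>_. 0) = (\<lambda>_. 0)" "matvec d (\<lambda>_ _. 0) v = (\<lambda>_. 0)"
  "matcomm d m (\<lambda>_ _. 0) = (\<lambda>_ _. 0)" "matcomm d (\<lambda>_ _. 0) m = (\<lambda>_ _. 0)"
  "wedge u (\<lambda>_. 0) = (\<lambda>_ _. 0)" "wedge (\<lambda>_. 0) u = (\<lambda>_ _. 0)"
  by (simp_all add: dot_def matvec_def matcomm_def wedge_def fun_eq_iff)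

lemma wedge_unit:
  "wedge (\<lambda>a. of_bool (a = i)) (\<lambda>a. of_bool (a = j)) = rot (genJ i j)"
  by (auto simp: wedge_def genJ_def fun_eq_iff)

lemma gen_coords:
  "mass genM = 1" "time genM = 0" "mom genM = (\<lambda>_. 0)" "boost genM = (\<lambda>_. 0)" "rot genM = (\<lambda>_ _. 0)"
  "mass genH = 0" "time genH = 1" "mom genH = (\<lambda>_. 0)" "boost genH = (\<lambda>_. 0)" "rot genH = (\<lambda>_ _. 0)"
  "mass (genP i) = 0" "time (genP i) = 0" "mom (genP i) = (\<lambda>a. of_bool (a = i))"
  "boost (genP i) = (\<lambda>_. 0)" "rot (genP i) = (\<lambda>_ _. 0)"
  "mass (genK i) = 0" "time (genK i) = 0" "mom (genK i) = (\<lambda>_. 0)"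
  "boost (genK i) = (\<lambda>a. of_bool (a = i))" "rot (genK i) = (\<lambda>_ _. 0)"
  "mass (genJ i j) = 0" "time (genJ i j) = 0" "mom (genJ i j) = (\<lambda>_. 0)" "boost (genJ i j) = (\<lambda>_. 0)"
  by (simp_all add: genM_def genH_def genP_def genK_def genJ_def czero_def)

lemmas bracket_simps = amb_bracket_def kin_bracket_def cadd_def cscale_def czero_def
  gen_coords dot_unit matvec_unit wedge_unit

lemma kin_commutators:
  assumes "i < d" "j < d"
  shows "kin_bracket c d (genK i) genH = cadd (cscale (KH_P c) (genP i)) (cscale (KH_K c) (genK i))"
    and "kin_bracket c d genH (genP i) = cadd (cscale (HP_P c) (genP i)) (cscale (HP_K c) (genK i))"
    and "kin_bracket c d (genK i) (genP j) =
           cadd (cscale (of_bool (i = j)) (cscale (KP_H c) genH)) (cscale (KP_J c) (genJ i j))"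
    and "kin_bracket c d (genK i) (genK j) = cscale (KK_J c) (genJ i j)"
    and "kin_bracket c d (genP i) (genP j) = cscale (PP_J c) (genJ i j)"
  using assms by (simp_all add: bracket_simps)

lemma amb_commutators:
  assumes "i < d" "j < d"
  shows "amb_bracket c d (genK i) genH = cadd (cscale (KH_P c) (genP i)) (cscale (KH_K c) (genK i))"
    and "amb_bracket c d genH (genP i) = cadd (cscale (HP_P c) (genP i)) (cscale (HP_K c) (genK i))"
    and "amb_bracket c d genM (genP i) = cadd (cscale (MP_P c) (genP i)) (cscale (MP_K c) (genK i))"
    and "amb_bracket c d genM (genK i) = cadd (cscale (MK_P c) (genP i)) (cscale (MK_K c) (genK i))"
    and "amb_bracket c d genH genM = cadd (cscale (HM_M c) genM) (cscale (HM_H c) genH)"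
    and "amb_bracket c d (genK i) (genP j) =
           cadd (cscale (of_bool (i = j)) (cadd (cscale (KP_M c) genM) (cscale (KP_H c) genH)))
                (cscale (KP_J c) (genJ i j))"
    and "amb_bracket c d (genK i) (genK j) = cscale (KK_J c) (genJ i j)"
    and "amb_bracket c d (genP i) (genP j) = cscale (PP_J c) (genJ i j)"
  using assms by (simp_all add: bracket_simps)

lemma rotation_commutators:
  assumes "i < d" "j < d" "k < d" "l < d"
  shows "amb_bracket c d (genJ i j) (genJ k l) =
           cadd (cadd (cscale (of_bool (j = k)) (genJ i l)) (cscale (- of_bool (j = l)) (genJ i k)))
                (cadd (cscale (of_bool (i = l)) (genJ j k)) (cscale (- of_bool (i = k)) (genJ j l)))"
    and "amb_bracket c d (genJ i j) (genP k) =
           cadd (cscale (- of_bool (i = k)) (genP j)) (cscale (of_bool (j = k)) (genP i))"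
    and "amb_bracket c d (genJ i j) (genK k) =
           cadd (cscale (- of_bool (i = k)) (genK j)) (cscale (of_bool (j = k)) (genK i))"
    and "amb_bracket c d (genJ i j) genH = czero"
    and "amb_bracket c d (genJ i j) genM = czero"
  using assms
  by (simp_all add: bracket_simps matcomm_genJ fun_eq_iff)
     (simp_all add: rot_genJ matunit_def of_bool_def)

lemma kin_bracket_eq_amb_bracket:
  assumes "mass x = 0" "mass y = 0" "KP_M c = 0"
  shows "kin_bracket c d x y = amb_bracket c d x y"
  using assms by (simp add: amb_bracket_def kin_bracket_def cadd_def)

text \<open>For \<open>d\<close>-dimensional space: the algebra, its isotropy \<open>K \<oplus> J\<close> and the decomposition.\<close>

definition amb :: "amb_coeffs \<Rightarrow> nat \<Rightarrow> coords klein" where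
  "amb c d =
     \<lparr>lie = \<lparr>carrier = amb_space d, monoid.mult = amb_bracket c d, one = undefined,
             zero = czero, add = cadd, module.smult = cscale\<rparr>,
      isotropy = {x \<in> amb_space d. mass x = 0 \<and> time x = 0 \<and> mom x = (\<lambda>_. 0)},
      rotations = {x \<in> amb_space d. mass x = 0 \<and> time x = 0 \<and> mom x = (\<lambda>_. 0) \<and> boost x = (\<lambda>_. 0)},
      scalars = {x \<in> amb_space d. mom x = (\<lambda>_. 0) \<and> boost x = (\<lambda>_. 0) \<and> rot x = (\<lambda>_ _. 0)},
      vectors = {x \<in> amb_space d. mass x = 0 \<and> time x = 0 \<and> rot x = (\<lambda>_ _. 0)}\<rparr>"

definition kin :: "kin_coeffs \<Rightarrow> nat \<Rightarrow> coords klein" where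
  "kin c d =
     \<lparr>lie = \<lparr>carrier = kin_space d, monoid.mult = kin_bracket c d, one = undefined,
             zero = czero, add = cadd, module.smult = cscale\<rparr>,
      isotropy = {x \<in> kin_space d. time x = 0 \<and> mom x = (\<lambda>_. 0)},
      rotations = {x \<in> kin_space d. time x = 0 \<and> mom x = (\<lambda>_. 0) \<and> boost x = (\<lambda>_. 0)},
      scalars = {x \<in> kin_space d. mom x = (\<lambda>_. 0) \<and> boost x = (\<lambda>_. 0) \<and> rot x = (\<lambda>_ _. 0)},
      vectors = {x \<in> kin_space d. time x = 0 \<and> rot x = (\<lambda>_ _. 0)}\<rparr>"

definition span_M :: "coords set" where
  "span_M = range (\<lambda>r. cscale r genM)"

definition universal_effective_kinematical :: "kin_coeffs \<Rightarrow> bool" where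
  "universal_effective_kinematical k \<longleftrightarrow>
     (\<forall>d\<ge>1. klein_pair (kin k d) \<and> effective (kin k d))"

definition universal_projectable :: "amb_coeffs \<Rightarrow> bool" where
  "universal_projectable c \<longleftrightarrow>
     (\<forall>d\<ge>1. klein_pair (amb c d) \<and> effective (amb c d) \<and>
        lie_ideal span_M (lie (amb c d)) \<and>
        klein_pair (klein_quotient (amb c d) span_M) \<and>
        effective (klein_quotient (amb c d) span_M))"

definition universal_triplet_isomorphic :: "amb_coeffs \<Rightarrow> amb_coeffs \<Rightarrow> bool" where
  "universal_triplet_isomorphic c c' \<longleftrightarrow>
     (\<forall>d\<ge>1. triplet_isomorphic (amb c d, span_M) (amb c' d, span_M))"

text \<open>\<open>c\<close> is a universal projectable ambient triplet into which \<open>k\<close> admits a lift.\<close>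

definition admits_lift :: "kin_coeffs \<Rightarrow> amb_coeffs \<Rightarrow> bool" where
  "admits_lift k c \<longleftrightarrow> universal_projectable c \<and>
     (\<forall>d\<ge>1. klein_isomorphic (kin k d) (klein_quotient (amb c d) span_M))"

section \<open>Bargmannian and G-ambient triplets\<close>

text \<open>
  The quotient of the ambient algebra by \<open>\<hh> = K \<oplus> J\<close> is identified with
  \<open>Span {M, H, P\<^sub>i}\<close>; the induced adjoint action of \<open>\<hh>\<close> is then the bracket followed by
  the projection along \<open>\<hh>\<close>.
\<close>

definition tangent_space :: "nat \<Rightarrow> coords set" where
  "tangent_space d = {x \<in> amb_space d. boost x = (\<lambda>_. 0) \<and> rot x = (\<lambda>_ _. 0)}"

definition isotropy_action :: "amb_coeffs \<Rightarrow> nat \<Rightarrow> coords \<Rightarrow> coords \<Rightarrow> coords" where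
  "isotropy_action c d a v =
     (amb_bracket c d a v)\<lparr>boost := (\<lambda>_. 0), rot := (\<lambda>_ _. 0)\<rparr>"

definition invariant_vector :: "amb_coeffs \<Rightarrow> nat \<Rightarrow> coords \<Rightarrow> bool" where
  "invariant_vector c d v \<longleftrightarrow>
     (\<forall>a\<in>isotropy (amb c d). isotropy_action c d a v = czero)"

definition invariant_covector :: "amb_coeffs \<Rightarrow> nat \<Rightarrow> (coords \<Rightarrow> real) \<Rightarrow> bool" where
  "invariant_covector c d \<phi> \<longleftrightarrow>
     (\<forall>a\<in>isotropy (amb c d). \<forall>v\<in>tangent_space d. \<phi> (isotropy_action c d a v) = 0)"

definition invariant_form ::
  "amb_coeffs \<Rightarrow> nat \<Rightarrow> coords set \<Rightarrow> (coords \<Rightarrow> coords \<Rightarrow> real) \<Rightarrow> bool" where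
  "invariant_form c d U \<beta> \<longleftrightarrow>
     (\<forall>a\<in>isotropy (amb c d). \<forall>v\<in>U. \<forall>w\<in>U.
        \<beta> (isotropy_action c d a v) w + \<beta> v (isotropy_action c d a w) = 0)"

text \<open>Invariance of \<open>\<xi> = M\<close>, \<open>\<psi> = - H\<^sup>*\<close> and \<open>\<gamma> = \<Sum>\<^sub>i P\<^sub>i\<^sup>* \<otimes> P\<^sub>i\<^sup>*\<close> on \<open>ker \<psi>\<close>.\<close>

definition invariant_xi_psi_gamma :: "amb_coeffs \<Rightarrow> nat \<Rightarrow> bool" where
  "invariant_xi_psi_gamma c d \<longleftrightarrow>
     invariant_vector c d genM \<and>
     invariant_covector c d (\<lambda>v. - time v) \<and>
     invariant_form c d {v \<in> tangent_space d. - time v = 0} (\<lambda>v w. dot d (mom v) (mom w))"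

definition bargmannian :: "amb_coeffs \<Rightarrow> bool" where
  "bargmannian c \<longleftrightarrow>
     (\<forall>d\<ge>1. invariant_xi_psi_gamma c d \<and>
        invariant_form c d (tangent_space d)
          (\<lambda>v w. - mass v * time w - time v * mass w + dot d (mom v) (mom w)))"

definition G_ambient :: "amb_coeffs \<Rightarrow> bool" where
  "G_ambient c \<longleftrightarrow>
     (\<forall>d\<ge>1. invariant_xi_psi_gamma c d \<and> invariant_covector c d mass)"

section \<open>The kinematical Klein pairs and their lifts\<close>

definition kin0 :: kin_coeffs where
  "kin0 = \<lparr>KH_P = 0, KH_K = 0, HP_P = 0, HP_K = 0, KP_H = 0, KP_J = 0, KK_J = 0, PP_J = 0\<rparr>"

definition carrollian_pairs :: "kin_coeffs set" where
  "carrollian_pairs =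
     {kin0\<lparr>KP_H := 1\<rparr>}
     \<union> {kin0\<lparr>KP_H := 1, HP_K := \<eta>, PP_J := \<eta>\<rparr> |\<eta>. \<eta> \<in> {1, -1}}
     \<union> {kin0\<lparr>KP_H := 1, KP_J := 1, HP_P := -1, KH_K := -1\<rparr>}"

definition riemannian_pairs :: "kin_coeffs set" where
  "riemannian_pairs =
     {kin0\<lparr>KK_J := -1, KP_H := 1, KH_P := -1, HP_K := \<eta>, PP_J := \<eta>\<rparr> |\<eta>. \<eta> \<in> {0, 1, -1}}"

definition lorentzian_pairs :: "kin_coeffs set" where
  "lorentzian_pairs =
     {kin0\<lparr>KK_J := 1, KP_H := 1, KH_P := 1, HP_K := \<eta>, PP_J := \<eta>\<rparr> |\<eta>. \<eta> \<in> {0, 1, -1}}"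

definition galilean_pair :: "real \<Rightarrow> real \<Rightarrow> kin_coeffs" where
  "galilean_pair \<epsilon> \<omega> = kin0\<lparr>KH_P := 1, HP_K := \<epsilon>, HP_P := \<omega>\<rparr>"

definition galilean_parameters :: "(real \<times> real) set" where
  "galilean_parameters =
     {(0, 0), (0, 1), (1, 0), (-1, 0)} \<union> {(1, \<alpha>) |\<alpha>. \<alpha> > 0} \<union> {(-1, \<alpha>) |\<alpha>. \<alpha> > 0}"

definition trivial_lift :: "kin_coeffs \<Rightarrow> amb_coeffs" where
  "trivial_lift k = kin_coeffs.extend k
     (amb_coeffs.fields 0 0 0 0 0 0 0)"

definition bargmannian_lift :: "real \<Rightarrow> real \<Rightarrow> amb_coeffs" where
  "bargmannian_lift \<epsilon> \<omega> = (trivial_lift (galilean_pair \<epsilon> \<omega>))\<lparr>KP_M := 1, HM_M := \<omega>\<rparr>"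

definition G_ambient_lift :: "real \<Rightarrow> real \<Rightarrow> real \<Rightarrow> amb_coeffs" where
  "G_ambient_lift \<epsilon> \<omega> \<mu> = (trivial_lift (galilean_pair \<epsilon> \<omega>))\<lparr>HM_M := \<mu>\<rparr>"

definition G_ambient_parameters :: "real \<Rightarrow> real \<Rightarrow> real set" where
  "G_ambient_parameters \<epsilon> \<omega> =
     (if \<omega> \<noteq> 0 then UNIV else if \<epsilon> = 0 then {0, 1} else {0..})"

end

theory Submission
  imports Defs
begin

text \<open>
  Once \<open>Span M\<close> is an ideal, the Jacobi identity in dimension 2 forces
  \<open>[K, K]\<close>, \<open>[P, P]\<close> and the \<open>J\<close>-part of \<open>[K, P]\<close> to be determined by the remaining
  coefficients, which satisfy three quadratic equations; conversely these conditions suffice for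
  the Jacobi identity in every dimension. In dimension 1 rotations vanish and each vector module
  is a line, so an isomorphism of Klein pairs is just a choice of numbers \<open>H \<mapsto> \<tau> H + n M\<close>,
  \<open>K \<mapsto> t K\<close>, \<open>P \<mapsto> s P + u K\<close>, \<open>M \<mapsto> \<mu> M\<close> obeying polynomial relations, and the same
  numbers define an isomorphism in every dimension. The classification is thereby reduced to
  solving these relations: if \<open>[K, P]\<close> has an \<open>H\<close>-part then \<open>M\<close> is central and is removed from
  \<open>[K, P]\<close> by the shift \<open>n\<close>; in the galilean case a non-zero \<open>M\<close>-part of \<open>[K, P]\<close> pins down
  \<open>[H, M]\<close>, and otherwise \<open>[H, M]\<close> is free up to the rescalings of \<open>H\<close> preserving the pair.
\<close>

section \<open>The Jacobi identity\<close>

text \<open>The two low dimensions complement each other. In dimension 1 the coefficients of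
  \<open>J\<close> are invisible, but the distinguished subspaces leave only a few numbers free.
  Dimension 2 is the first in which \<open>J\<close> is non-zero, and it recovers the lost
  coefficients. As admissibility expresses these through the others, isomorphism data found in
  dimension 1 extend to all dimensions. Uniqueness does not pass through a classification of
  kinematical pairs. If \<open>k\<close> lifts to \<open>c\<close>, an isomorphism from
  \<open>kin k\<close> to the quotient already supplies \<open>\<tau>\<close>, \<open>s\<close>,
  \<open>t\<close>, \<open>u\<close>; it remains to choose \<open>\<mu>\<close> and
  \<open>n\<close>. Only two equations involve \<open>M\<close>: the one for \<open>[K, P]\<close>
  is met by this choice, whereas the one for \<open>[H, M]\<close> contains no free number. The
  latter either follows from the Jacobi identity or is the origin of the modulus in the G-ambient
  family. The shear \<open>u\<close> is present because an isomorphism preserves \<open>K\<close>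
  but only the sum of the two vector modules, so \<open>P\<close> may acquire a
  \<open>K\<close>-part.\<close>

lemma coords_eq_iff:
  fixes x y :: coords
  shows "x = y \<longleftrightarrow> mass x = mass y \<and> time x = time y \<and> mom x = mom y \<and> boost x = boost y \<and> rot x = rot y"
  by (cases x; cases y) simp

lemma coords_sel [simp]:
  "mass czero = 0" "time czero = 0" "mom czero = (\<lambda>_. 0)" "boost czero = (\<lambda>_. 0)" "rot czero = (\<lambda>_ _. 0)"
  "mass (cadd x y) = mass x + mass y" "time (cadd x y) = time x + time y"
  "mom (cadd x y) = (\<lambda>i. mom x i + mom y i)" "boost (cadd x y) = (\<lambda>i. boost x i + boost y i)"
  "rot (cadd x y) = (\<lambda>i j. rot x i j + rot y i j)"
  "mass (cscale r x) = r * mass x" "time (cscale r x) = r * time x"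
  "mom (cscale r x) = (\<lambda>i. r * mom x i)" "boost (cscale r x) = (\<lambda>i. r * boost x i)"
  "rot (cscale r x) = (\<lambda>i j. r * rot x i j)"
  by (simp_all add: czero_def cadd_def cscale_def)

declare gen_coords [simp]

lemma amb_bracket_sel:
  "mass (amb_bracket c d x y) = KP_M c * (dot d (boost x) (mom y) - dot d (boost y) (mom x))
              + HM_M c * (time x * mass y - time y * mass x)"
  "time (amb_bracket c d x y) = KP_H c * (dot d (boost x) (mom y) - dot d (boost y) (mom x))
              + HM_H c * (time x * mass y - time y * mass x)"
  "mom (amb_bracket c d x y) = (\<lambda>i. matvec d (rot x) (mom y) i - matvec d (rot y) (mom x) i
                 + KH_P c * (boost x i * time y - boost y i * time x)
                 + HP_P c * (time x * mom y i - time y * mom x i)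
                 + (MP_P c * (mass x * mom y i - mass y * mom x i)
                  + MK_P c * (mass x * boost y i - mass y * boost x i)))"
  "boost (amb_bracket c d x y) = (\<lambda>i. matvec d (rot x) (boost y) i - matvec d (rot y) (boost x) i
                 + KH_K c * (boost x i * time y - boost y i * time x)
                 + HP_K c * (time x * mom y i - time y * mom x i)
                 + (MP_K c * (mass x * mom y i - mass y * mom x i)
                  + MK_K c * (mass x * boost y i - mass y * boost x i)))"
  "rot (amb_bracket c d x y) = (\<lambda>i j. matcomm d (rot x) (rot y) i j
                 + KP_J c * (wedge (boost x) (mom y) i j - wedge (boost y) (mom x) i j)
                 + KK_J c * wedge (boost x) (boost y) i j
                 + PP_J c * wedge (mom x) (mom y) i j)"
  by (simp_all add: amb_bracket_def kin_bracket_def)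

section \<open>Bilinearity and the action of rotations\<close>

lemma dot_lin:
  "dot d (\<lambda>i. u i + v i) w = dot d u w + dot d v w" "dot d w (\<lambda>i. u i + v i) = dot d w u + dot d w v"
  "dot d (\<lambda>i. u i - v i) w = dot d u w - dot d v w" "dot d w (\<lambda>i. u i - v i) = dot d w u - dot d w v"
  "dot d (\<lambda>i. r * u i) w = r * dot d u w" "dot d w (\<lambda>i. r * u i) = r * dot d w u"
  "dot d (\<lambda>i. u i * r) w = r * dot d u w" "dot d w (\<lambda>i. u i * r) = r * dot d w u"
  by (simp_all add: dot_def algebra_simps sum.distrib sum_subtractf sum_distrib_left)

lemma dot_commute: "dot d u v = dot d v u"
  by (simp add: dot_def mult.commute)

lemma matvec_lin:
  "matvec d m (\<lambda>i. u i + v i) k = matvec d m u k + matvec d m v k"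
  "matvec d m (\<lambda>i. u i - v i) k = matvec d m u k - matvec d m v k"
  "matvec d m (\<lambda>i. r * u i) k = r * matvec d m u k"
  "matvec d m (\<lambda>i. u i * r) k = r * matvec d m u k"
  "matvec d (\<lambda>i j. m i j + m' i j) u k = matvec d m u k + matvec d m' u k"
  "matvec d (\<lambda>i j. m i j - m' i j) u k = matvec d m u k - matvec d m' u k"
  "matvec d (\<lambda>i j. r * m i j) u k = r * matvec d m u k"
  "matvec d (\<lambda>_ _. 0) u k = 0"
  by (simp_all add: matvec_def algebra_simps sum.distrib sum_subtractf sum_distrib_left)

lemma matcomm_lin:
  "matcomm d (\<lambda>i j. m i j + m' i j) n k l = matcomm d m n k l + matcomm d m' n k l"
  "matcomm d n (\<lambda>i j. m i j + m' i j) k l = matcomm d n m k l + matcomm d n m' k l"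
  "matcomm d (\<lambda>i j. m i j - m' i j) n k l = matcomm d m n k l - matcomm d m' n k l"
  "matcomm d n (\<lambda>i j. m i j - m' i j) k l = matcomm d n m k l - matcomm d n m' k l"
  "matcomm d (\<lambda>i j. r * m i j) n k l = r * matcomm d m n k l"
  "matcomm d n (\<lambda>i j. r * m i j) k l = r * matcomm d n m k l"
  by (simp_all add: matcomm_def algebra_simps sum.distrib sum_subtractf sum_distrib_left)

text \<open>In the Jacobi sum this turns the rotation part of a bracket of two vectors, acting on a
  third, into dot products, where it meets the contribution of the scalar part.\<close>

lemma matvec_wedge: "matvec d (wedge u v) w k = u k * dot d v w - v k * dot d u w"
  by (simp add: matvec_def wedge_def dot_def algebra_simps sum_subtractf sum_distrib_left)

lemma matvec_matcomm:
  "matvec d (matcomm d m n) v k = matvec d m (matvec d n v) k - matvec d n (matvec d m v) k"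
proof -
  have *: "(\<Sum>j<d. \<Sum>l<d. a k l * (b l j * v j)) = (\<Sum>l<d. \<Sum>j<d. a k l * (b l j * v j))" for a b :: "nat \<Rightarrow> nat \<Rightarrow> real"
    by (rule sum.swap)
  show ?thesis
    by (simp add: matvec_def matcomm_def sum_distrib_left sum_distrib_right left_diff_distrib sum_subtractf mult.assoc *)
qed

text \<open>Skew matrices are infinitesimal isometries; hence rotations cancel from the scalar
  components of the Jacobi sum.\<close>

lemma dot_matvec_skew:
  assumes "\<And>i j. m i j = - m j i"
  shows "dot d (matvec d m u) v = - dot d u (matvec d m v)"
proof -
  have "dot d (matvec d m u) v = (\<Sum>i<d. \<Sum>j<d. m i j * u j * v i)"
    by (simp add: dot_def matvec_def sum_distrib_right)
  also have "\<dots> = (\<Sum>j<d. \<Sum>i<d. m i j * u j * v i)"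
    by (rule sum.swap)
  also have "\<dots> = (\<Sum>j<d. \<Sum>i<d. - (u j * (m j i * v i)))"
    by (intro sum.cong refl) (subst assms, simp)
  also have "\<dots> = - dot d u (matvec d m v)"
    by (simp add: dot_def matvec_def sum_distrib_left sum_negf)
  finally show ?thesis .
qed

text \<open>As a matrix the wedge is \<open>u v^T - v u^T\<close>. Since \<open>m^T = - m\<close>,
  the commutator with \<open>m\<close> acts on it as a derivation.\<close>

lemma matcomm_wedge_skew:
  assumes "\<And>i j. m i j = - m j i"
  shows "matcomm d m (wedge u v) k l = wedge (matvec d m u) v k l + wedge u (matvec d m v) k l"
proof -
  have "matcomm d m (wedge u v) k l = (\<Sum>j<d. m k j * (u j * v l - u l * v j) + (u k * v j - u j * v k) * m l j)"
    unfolding matcomm_def wedge_def by (intro sum.cong refl) (subst assms[of _ l], simp)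
  then show ?thesis
    by (simp add: wedge_def matvec_def algebra_simps sum.distrib sum_subtractf sum_distrib_left)
qed

lemma matcomm_jacobi:
  "matcomm d a (matcomm d b c) i j + matcomm d b (matcomm d c a) i j + matcomm d c (matcomm d a b) i j = 0"
proof -
  \<comment> \<open>Writing every triple product with its two sums nested in the same order makes
    the twelve terms of the cyclic sum cancel pairwise.\<close>
  define T where "T x y z = (\<Sum>l<d. \<Sum>r<d. x i l * (y l r * z r j))" for x y z :: "nat \<Rightarrow> nat \<Rightarrow> real"
  have *: "matcomm d x (matcomm d y z) i j = T x y z - T x z y - T y z x + T z y x"
    for x y z
  proof -
    have sw: "(\<Sum>l<d. (\<Sum>r<d. y i r * z r l) * x l j) = T y z x" for y z :: "nat \<Rightarrow> nat \<Rightarrow> real"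
      unfolding T_def sum_distrib_right by (subst sum.swap) (simp add: mult.assoc)
    show ?thesis
      using sw[of y z] sw[of z y]
      by (simp add: matcomm_def T_def sum_subtractf right_diff_distrib left_diff_distrib sum_distrib_left)
  qed
  show ?thesis by (simp add: *)
qed

lemma wedge_lin:
  "wedge (\<lambda>i. u i + v i) w k l = wedge u w k l + wedge v w k l" "wedge w (\<lambda>i. u i + v i) k l = wedge w u k l + wedge w v k l"
  "wedge (\<lambda>i. u i - v i) w k l = wedge u w k l - wedge v w k l" "wedge w (\<lambda>i. u i - v i) k l = wedge w u k l - wedge w v k l"
  "wedge (\<lambda>i. r * u i) w k l = r * wedge u w k l" "wedge w (\<lambda>i. r * u i) k l = r * wedge w u k l"
  "wedge (\<lambda>i. u i * r) w k l = r * wedge u w k l" "wedge w (\<lambda>i. u i * r) k l = r * wedge w u k l"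
  by (simp_all add: wedge_def algebra_simps)

lemmas lin_simps = dot_lin matvec_lin matcomm_lin wedge_lin

text \<open>
  The Jacobi identities: the formulas for \<open>KK_J\<close>, \<open>KP_J\<close>, \<open>PP_J\<close> come from \<open>(K, K, P)\<close> and
  \<open>(K, P, P)\<close>, which also gives \<open>KP_J = - KP_H * HP_P\<close>; the last two come from \<open>(M, K, P)\<close> and
  \<open>(H, K, P)\<close>. The first five say that \<open>Span M\<close> is an ideal.
\<close>

definition admissible :: "amb_coeffs \<Rightarrow> bool" where
  "admissible c \<longleftrightarrow>
     HM_H c = 0 \<and> MP_P c = 0 \<and> MP_K c = 0 \<and> MK_P c = 0 \<and> MK_K c = 0 \<and>
     KK_J c = KP_H c * KH_P c \<and> KP_J c = - (KP_H c * KH_K c) \<and> PP_J c = KP_H c * HP_K c \<and>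
     KP_H c * (HP_P c - KH_K c) = 0 \<and> KP_H c * HM_M c = 0 \<and>
     KP_M c * (HM_M c + KH_K c - HP_P c) = 0"

text \<open>Resolving the three products into linear equations makes them usable as rewrite rules.
  The branches foreshadow the classification: no scalar in \<open>[K, P]\<close>,
  \<open>[H, M]\<close> determined by the action of \<open>H\<close> on the vectors,
  \<open>M\<close> central.\<close>

lemma admissible_cases:
  assumes "admissible c"
  obtains "KP_H c = 0" "KP_M c = 0" | "KP_H c = 0" "HM_M c = HP_P c - KH_K c" | "HM_M c = 0" "HP_P c = KH_K c"
  using assms by (auto simp: admissible_def)

text \<open>After bilinear expansion the vectors enter only through dot products, wedges and matrix
  actions. The rotation identities above then leave, in each branch, a polynomial identity in the
  coefficients.\<close>

lemma amb_bracket_jacobi: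
  assumes c: "admissible c"
    and sk: "\<And>i j. rot x i j = - rot x j i" "\<And>i j. rot y i j = - rot y j i" "\<And>i j. rot z i j = - rot z j i"
  shows "cadd (cadd (amb_bracket c d x (amb_bracket c d y z)) (amb_bracket c d y (amb_bracket c d z x)))
          (amb_bracket c d z (amb_bracket c d x y)) = czero"
proof -
  have red: "HM_H c = 0" "MP_P c = 0" "MP_K c = 0" "MK_P c = 0" "MK_K c = 0"
    "KK_J c = KP_H c * KH_P c" "KP_J c = - (KP_H c * KH_K c)" "PP_J c = KP_H c * HP_K c"
    using c by (auto simp: admissible_def)
  note cases = admissible_cases[OF c]
  note dm = dot_matvec_skew[OF sk(1)] dot_matvec_skew[OF sk(2)] dot_matvec_skew[OF sk(3)]
  note mw = matcomm_wedge_skew[OF sk(1)] matcomm_wedge_skew[OF sk(2)] matcomm_wedge_skew[OF sk(3)]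
  \<comment> \<open>Each dot product gets one fixed orientation, boosts before momenta and
    \<open>x\<close> before \<open>y\<close> before \<open>z\<close>, so that equal ones become
    syntactically equal.\<close>
  note dc = dot_commute[of d "mom x" "boost x"] dot_commute[of d "mom x" "boost y"] dot_commute[of d "mom x" "boost z"]
       dot_commute[of d "mom y" "boost x"] dot_commute[of d "mom y" "boost y"] dot_commute[of d "mom y" "boost z"]
       dot_commute[of d "mom z" "boost x"] dot_commute[of d "mom z" "boost y"] dot_commute[of d "mom z" "boost z"]
       dot_commute[of d "mom y" "mom x"] dot_commute[of d "mom z" "mom x"] dot_commute[of d "mom z" "mom y"]
       dot_commute[of d "boost y" "boost x"] dot_commute[of d "boost z" "boost x"] dot_commute[of d "boost z" "boost y"]
  show ?thesis unfolding coords_eq_iff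
  proof (intro conjI ext)
    show "mass (cadd (cadd (amb_bracket c d x (amb_bracket c d y z)) (amb_bracket c d y (amb_bracket c d z x)))
          (amb_bracket c d z (amb_bracket c d x y))) = mass czero"
      by (rule cases; simp add: amb_bracket_sel red lin_simps dm dc; simp add: algebra_simps)
  next
    show "time (cadd (cadd (amb_bracket c d x (amb_bracket c d y z)) (amb_bracket c d y (amb_bracket c d z x)))
          (amb_bracket c d z (amb_bracket c d x y))) = time czero"
      by (rule cases; simp add: amb_bracket_sel red lin_simps dm dc; simp add: algebra_simps)
  next
    fix i
    show "mom (cadd (cadd (amb_bracket c d x (amb_bracket c d y z)) (amb_bracket c d y (amb_bracket c d z x)))
          (amb_bracket c d z (amb_bracket c d x y))) i = mom czero i"
      by (rule cases; simp add: amb_bracket_sel red lin_simps matvec_wedge matvec_matcomm dc; simp add: algebra_simps)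
  next
    fix i
    show "boost (cadd (cadd (amb_bracket c d x (amb_bracket c d y z)) (amb_bracket c d y (amb_bracket c d z x)))
          (amb_bracket c d z (amb_bracket c d x y))) i = boost czero i"
      by (rule cases; simp add: amb_bracket_sel red lin_simps matvec_wedge matvec_matcomm dc; simp add: algebra_simps)
  next
    fix i j
    show "rot (cadd (cadd (amb_bracket c d x (amb_bracket c d y z)) (amb_bracket c d y (amb_bracket c d z x)))
          (amb_bracket c d z (amb_bracket c d x y))) i j = rot czero i j"
      using matcomm_jacobi[of d "rot x" "rot y" "rot z" i j]
      by - (rule cases; simp add: amb_bracket_sel red lin_simps mw; simp add: wedge_def algebra_simps)
  qed
qed

section \<open>The Lie algebras in coordinates\<close>

lemma real_ring_simps [simp]:
  "carrier real_ring = UNIV" "\<one>\<^bsub>real_ring\<^esub> = 1" "x \<otimes>\<^bsub>real_ring\<^esub> y = x * y" "x \<oplus>\<^bsub>real_ring\<^esub> y = x + y"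
  by (simp_all add: ring_of_type_algebra_def)

lemma amb_spaceD:
  assumes "x \<in> amb_space d"
  shows "i \<ge> d \<Longrightarrow> mom x i = 0" "i \<ge> d \<Longrightarrow> boost x i = 0" "rot x i j = - rot x j i"
    "i \<ge> d \<or> j \<ge> d \<Longrightarrow> rot x i j = 0"
  using assms unfolding amb_space_def by blast+

lemma amb_spaceI:
  assumes "\<And>i. i \<ge> d \<Longrightarrow> mom x i = 0" "\<And>i. i \<ge> d \<Longrightarrow> boost x i = 0"
    "\<And>i j. i \<ge> d \<or> j \<ge> d \<Longrightarrow> rot x i j = 0" "\<And>i j. rot x i j = - rot x j i"
  shows "x \<in> amb_space d"
  unfolding amb_space_def using assms by blast

lemma amb_space_closed:
  "czero \<in> amb_space d"
  "x \<in> amb_space d \<Longrightarrow> y \<in> amb_space d \<Longrightarrow> cadd x y \<in> amb_space d"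
  "x \<in> amb_space d \<Longrightarrow> cscale r x \<in> amb_space d"
proof -
  show "czero \<in> amb_space d" by (simp add: amb_space_def)
  show "cadd x y \<in> amb_space d" if xy: "x \<in> amb_space d" "y \<in> amb_space d"
  proof (rule amb_spaceI)
    show "rot (cadd x y) i j = - rot (cadd x y) j i" for i j
      using amb_spaceD(3)[OF xy(1), of i j] amb_spaceD(3)[OF xy(2), of i j] by simp
  qed (simp_all add: amb_spaceD(1,2,4)[OF xy(1)] amb_spaceD(1,2,4)[OF xy(2)])
  show "cscale r x \<in> amb_space d" if x: "x \<in> amb_space d"
  proof (rule amb_spaceI)
    show "rot (cscale r x) i j = - rot (cscale r x) j i" for i j
      using amb_spaceD(3)[OF x, of i j] by simp
  qed (simp_all add: amb_spaceD(1,2,4)[OF x])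
qed

lemma kin_space_closed:
  "czero \<in> kin_space d"
  "x \<in> kin_space d \<Longrightarrow> y \<in> kin_space d \<Longrightarrow> cadd x y \<in> kin_space d"
  "x \<in> kin_space d \<Longrightarrow> cscale r x \<in> kin_space d"
  by (simp_all add: kin_space_def amb_space_closed)

lemma gens_in_space [simp]:
  "genM \<in> amb_space d" "genH \<in> amb_space d" "i < d \<Longrightarrow> genP i \<in> amb_space d" "i < d \<Longrightarrow> genK i \<in> amb_space d"
  "i < d \<Longrightarrow> j < d \<Longrightarrow> genJ i j \<in> amb_space d"
proof -
  show "i < d \<Longrightarrow> j < d \<Longrightarrow> genJ i j \<in> amb_space d"
  proof (rule amb_spaceI)
    show "rot (genJ i j) a b = - rot (genJ i j) b a" for a b
      unfolding rot_genJ matunit_def by (simp only: conj_commute minus_diff_eq)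
    show "rot (genJ i j) a b = 0" if "i < d" "j < d" "a \<ge> d \<or> b \<ge> d" for a b
      using that unfolding rot_genJ matunit_def by auto
  qed simp_all
  show "genM \<in> amb_space d" by (rule amb_spaceI) simp_all
  show "genH \<in> amb_space d" by (rule amb_spaceI) simp_all
  show "i < d \<Longrightarrow> genP i \<in> amb_space d" by (rule amb_spaceI) simp_all
  show "i < d \<Longrightarrow> genK i \<in> amb_space d" by (rule amb_spaceI) simp_all
qed

lemma gens_in_kin_space [simp]:
  "genH \<in> kin_space d" "i < d \<Longrightarrow> genP i \<in> kin_space d" "i < d \<Longrightarrow> genK i \<in> kin_space d"
  "i < d \<Longrightarrow> j < d \<Longrightarrow> genJ i j \<in> kin_space d"
  by (auto simp: kin_space_def)

lemma amb_bracket_closed: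
  assumes x: "x \<in> amb_space d" and y: "y \<in> amb_space d"
  shows "amb_bracket c d x y \<in> amb_space d"
proof -
  have mc: "matcomm d (rot x) (rot y) i j = - matcomm d (rot x) (rot y) j i" for i j
  proof -
    have "rot x i l * rot y l j - rot y i l * rot x l j = - (rot x j l * rot y l i - rot y j l * rot x l i)" for l
      by (simp add: amb_spaceD(3)[OF x, of i l] amb_spaceD(3)[OF y, of l j] amb_spaceD(3)[OF y, of i l]
          amb_spaceD(3)[OF x, of l j] mult.commute)
    then show ?thesis
      by (simp add: matcomm_def sum_negf[symmetric])
  qed
  have w: "wedge u v i j = - wedge u v j i" for u v i j
    by (simp add: wedge_def)
  have "mom (amb_bracket c d x y) i = 0 \<and> boost (amb_bracket c d x y) i = 0" if "i \<ge> d" for i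
    using that by (simp add: amb_bracket_sel amb_spaceD(1,2,4)[OF x] amb_spaceD(1,2,4)[OF y] matvec_def)
  moreover have "rot (amb_bracket c d x y) i j = - rot (amb_bracket c d x y) j i" for i j
    by (simp add: amb_bracket_sel mc[of i j] w[of _ _ i j] algebra_simps)
  moreover have "rot (amb_bracket c d x y) i j = 0" if "i \<ge> d \<or> j \<ge> d" for i j
    using that
    by (auto simp: amb_bracket_sel amb_spaceD(1,2,4)[OF x] amb_spaceD(1,2,4)[OF y] matcomm_def wedge_def)
  ultimately show ?thesis by (intro amb_spaceI) blast+
qed

lemma bracket_bilinear:
  "amb_bracket c d (cadd x y) z = cadd (amb_bracket c d x z) (amb_bracket c d y z)"
  "amb_bracket c d z (cadd x y) = cadd (amb_bracket c d z x) (amb_bracket c d z y)"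
  "amb_bracket c d (cscale r x) y = cscale r (amb_bracket c d x y)"
  "amb_bracket c d x (cscale r y) = cscale r (amb_bracket c d x y)"
  by (simp_all add: coords_eq_iff amb_bracket_sel lin_simps fun_eq_iff distrib_left)
     (simp_all add: algebra_simps)

lemma bracket_alternating: "amb_bracket c d x x = czero"
  by (simp add: coords_eq_iff amb_bracket_sel fun_eq_iff matcomm_def wedge_def)

text \<open>The map \<open>E\<close> abstracts from the kind of coordinate, so that one induction on
  the support serves momenta, boosts and, with pairs as indices, rotations.\<close>

lemma coord_span_induct:
  fixes E :: "('i \<Rightarrow> real) \<Rightarrow> coords"
  assumes "finite F"
    and E: "\<And>u v. E (\<lambda>i. u i + v i) = cadd (E u) (E v)" "\<And>r u. E (\<lambda>i. r * u i) = cscale r (E u)"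
    and N: "czero \<in> N" "\<And>x y. x \<in> N \<Longrightarrow> y \<in> N \<Longrightarrow> cadd x y \<in> N" "\<And>r x. x \<in> N \<Longrightarrow> cscale r x \<in> N"
    and gen: "\<And>i. i \<in> F \<Longrightarrow> E (\<lambda>a. of_bool (a = i)) \<in> N"
    and supp: "\<And>i. i \<notin> F \<Longrightarrow> u i = 0"
  shows "E u \<in> N"
  using \<open>finite F\<close> gen supp
proof (induction F arbitrary: u rule: finite_induct)
  case empty
  \<comment> \<open>That \<open>E\<close> sends zero to \<open>czero\<close> is extracted from
    homogeneity with factor 0.\<close>
  then have "u = (\<lambda>i. 0 * u i)" by auto
  then have "E u = E (\<lambda>i. 0 * u i)" by (rule arg_cong)
  also have "\<dots> = czero" unfolding E(2) by (simp add: coords_eq_iff)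
  finally have "E u = czero" .
  then show ?case using N(1) by simp
next
  case (insert j F)
  have u: "u = (\<lambda>i. (u(j := 0)) i + u j * of_bool (i = j))" by auto
  have "E (u(j := 0)) \<in> N"
  proof (rule insert.IH)
    show "(u(j := 0)) i = 0" if "i \<notin> F" for i
      using insert.prems(2)[of i] that by auto
  qed (use insert.prems(1) in auto)
  moreover have "E (\<lambda>i. u j * of_bool (i = j)) \<in> N"
    unfolding E(2) using insert.prems(1) N(3) by blast
  ultimately have "cadd (E (u(j := 0))) (E (\<lambda>i. u j * of_bool (i = j))) \<in> N"
    by (rule N(2))
  then show ?case
    unfolding E(1)[symmetric] u[symmetric] .
qed

text \<open>The disjunction on \<open>genM\<close> covers the ambient algebra and the kinematical
  one, whose elements have mass zero, at the same time.\<close>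

lemma coord_span:
  assumes N: "czero \<in> N" "\<And>x y. x \<in> N \<Longrightarrow> y \<in> N \<Longrightarrow> cadd x y \<in> N" "\<And>r x. x \<in> N \<Longrightarrow> cscale r x \<in> N"
    and gen: "genH \<in> N" "\<And>i. i < d \<Longrightarrow> genP i \<in> N" "\<And>i. i < d \<Longrightarrow> genK i \<in> N"
      "\<And>i j. i < d \<Longrightarrow> j < d \<Longrightarrow> genJ i j \<in> N"
    and x: "x \<in> amb_space d" and M: "mass x = 0 \<or> genM \<in> N"
  shows "x \<in> N"
proof -
  have M: "cscale (mass x) genM \<in> N"
  proof (cases "mass x = 0")
    case True
    then have "cscale (mass x) genM = czero" by (simp add: coords_eq_iff)
    then show ?thesis using N(1) by simp
  qed (use M N(3) in auto)
  have P: "czero\<lparr>mom := mom x\<rparr> \<in> N"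
    by (rule coord_span_induct[of "{..<d}" "\<lambda>u. czero\<lparr>mom := u\<rparr>"])
       (use N gen amb_spaceD(1,2)[OF x] in \<open>auto simp: coords_eq_iff genP_def\<close>)
  have K: "czero\<lparr>boost := boost x\<rparr> \<in> N"
    by (rule coord_span_induct[of "{..<d}" "\<lambda>u. czero\<lparr>boost := u\<rparr>"])
       (use N gen amb_spaceD(1,2)[OF x] in \<open>auto simp: coords_eq_iff genK_def\<close>)
  \<comment> \<open>Coefficient functions on index pairs are antisymmetrised, so that the basis
    function at \<open>(i, j)\<close> becomes \<open>genJ i j\<close>. Both \<open>(i, j)\<close>
    and \<open>(j, i)\<close> contribute to an entry of \<open>rot x\<close>; therefore the
    coefficients are halved.\<close>
  let ?E = "\<lambda>u. czero\<lparr>rot := (\<lambda>i j. u (i, j) - u (j, i))\<rparr>"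
  have "?E (\<lambda>(i, j). rot x i j / 2) \<in> N"
  proof (rule coord_span_induct[of "{..<d} \<times> {..<d}" ?E, OF _ _ _ N])
    fix p assume "p \<in> {..<d} \<times> {..<d}"
    moreover have "?E (\<lambda>a. of_bool (a = p)) = genJ (fst p) (snd p)"
      by (cases p) (auto simp: coords_eq_iff genJ_def fun_eq_iff)
    ultimately show "?E (\<lambda>a. of_bool (a = p)) \<in> N"
      using gen(4) by auto
  next
    show "(case p of (i, j) \<Rightarrow> rot x i j / 2) = 0" if p: "p \<notin> {..<d} \<times> {..<d}" for p
    proof -
      obtain a b where "p = (a, b)" "a \<ge> d \<or> b \<ge> d"
        using p by (cases p) (auto simp: not_less)
      then show ?thesis using amb_spaceD(4)[OF x] by auto
    qed
  qed (auto simp: coords_eq_iff algebra_simps)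
  moreover have "?E (\<lambda>(i, j). rot x i j / 2) = czero\<lparr>rot := rot x\<rparr>"
  proof -
    have "rot x i j / 2 - rot x j i / 2 = rot x i j" for i j
      using amb_spaceD(3)[OF x, of i j] by simp
    then show ?thesis by simp
  qed
  ultimately have J: "czero\<lparr>rot := rot x\<rparr> \<in> N" by simp
  have "x = cadd (cscale (mass x) genM) (cadd (cscale (time x) genH)
      (cadd (czero\<lparr>mom := mom x\<rparr>) (cadd (czero\<lparr>boost := boost x\<rparr>) (czero\<lparr>rot := rot x\<rparr>))))"
    by (simp add: coords_eq_iff)
  also have "\<dots> \<in> N"
    by (intro N M P K J gen)
  finally show ?thesis .
qed

text \<open>Ambient and kinematical algebras share the vector operations; only carrier and bracket
  vary.\<close>

definition coord_lie :: "coords set \<Rightarrow> (coords \<Rightarrow> coords \<Rightarrow> coords) \<Rightarrow> (real, coords) module" where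
  "coord_lie S br = \<lparr>carrier = S, monoid.mult = br, one = undefined, zero = czero, add = cadd, module.smult = cscale\<rparr>"

lemma coord_lie_sel [simp]:
  "carrier (coord_lie S br) = S" "x \<otimes>\<^bsub>coord_lie S br\<^esub> y = br x y" "\<zero>\<^bsub>coord_lie S br\<^esub> = czero"
  "x \<oplus>\<^bsub>coord_lie S br\<^esub> y = cadd x y" "r \<odot>\<^bsub>coord_lie S br\<^esub> x = cscale r x"
  by (simp_all add: coord_lie_def)

lemma lie_amb [simp]: "lie (amb c d) = coord_lie (amb_space d) (amb_bracket c d)"
  by (simp add: amb_def coord_lie_def)

lemma lie_kin [simp]: "lie (kin k d) = coord_lie (kin_space d) (kin_bracket k d)"
  by (simp add: kin_def coord_lie_def)

lemma abelian_group_coord_lie: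
  assumes "czero \<in> S" "\<And>x y. x \<in> S \<Longrightarrow> y \<in> S \<Longrightarrow> cadd x y \<in> S" "\<And>r x. x \<in> S \<Longrightarrow> cscale r x \<in> S"
  shows "abelian_group (coord_lie S br)"
proof (rule abelian_groupI)
  fix x assume "x \<in> carrier (coord_lie S br)"
  then have "cscale (-1) x \<in> S" using assms by simp
  then show "\<exists>y\<in>carrier (coord_lie S br). y \<oplus>\<^bsub>coord_lie S br\<^esub> x = \<zero>\<^bsub>coord_lie S br\<^esub>"
    by (intro bexI[of _ "cscale (-1) x"]) (simp_all add: coords_eq_iff)
qed (simp_all add: assms coords_eq_iff algebra_simps)

lemma module_coord_lie:
  assumes "czero \<in> S" "\<And>x y. x \<in> S \<Longrightarrow> y \<in> S \<Longrightarrow> cadd x y \<in> S" "\<And>r x. x \<in> S \<Longrightarrow> cscale r x \<in> S"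
  shows "module real_ring (coord_lie S br)"
  by (rule moduleI)
     (use assms abelian_group_coord_lie[of S] in \<open>auto simp: coords_eq_iff algebra_simps\<close>)

lemma submodule_coord_lie:
  assumes "submodule N real_ring (coord_lie S br)"
  shows "N \<subseteq> S" "czero \<in> N" "x \<in> N \<Longrightarrow> y \<in> N \<Longrightarrow> cadd x y \<in> N" "x \<in> N \<Longrightarrow> cscale r x \<in> N"
proof -
  interpret submodule N real_ring "coord_lie S br" by fact
  show "N \<subseteq> S" "czero \<in> N" "x \<in> N \<Longrightarrow> y \<in> N \<Longrightarrow> cadd x y \<in> N" "x \<in> N \<Longrightarrow> cscale r x \<in> N"
    using subset one_closed m_closed smult_closed by auto
qed

text \<open>All bracket axioms are inherited from \<open>amb_bracket\<close>, with which
  \<open>br\<close> agrees on \<open>S\<close>; only closure and a finite generating set are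
  specific to \<open>S\<close>.\<close>

lemma lie_algebra_coord_lie:
  assumes c: "admissible c" and S: "S = amb_space d \<or> S = kin_space d"
    and br: "\<And>x y. x \<in> S \<Longrightarrow> y \<in> S \<Longrightarrow> br x y = amb_bracket c d x y"
    and cl: "\<And>x y. x \<in> S \<Longrightarrow> y \<in> S \<Longrightarrow> br x y \<in> S"
  shows "lie_algebra (coord_lie S br)"
proof -
  have S': "czero \<in> S" "\<And>x y. x \<in> S \<Longrightarrow> y \<in> S \<Longrightarrow> cadd x y \<in> S" "\<And>r x. x \<in> S \<Longrightarrow> cscale r x \<in> S"
    "S \<subseteq> amb_space d"
    using S amb_space_closed kin_space_closed by (auto simp: kin_space_def)
  have cl': "amb_bracket c d x y \<in> S" if "x \<in> S" "y \<in> S" for x y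
    using br[OF that] cl[OF that] by simp
  interpret module real_ring "coord_lie S br"
    by (rule module_coord_lie[OF S'(1-3)])
  show ?thesis
  proof
    fix x y z assume *: "x \<in> carrier (coord_lie S br)" "y \<in> carrier (coord_lie S br)" "z \<in> carrier (coord_lie S br)"
    then have m: "x \<in> amb_space d" "y \<in> amb_space d" "z \<in> amb_space d"
      using S'(4) by auto
    note J = amb_bracket_jacobi[OF c amb_spaceD(3)[OF m(1)] amb_spaceD(3)[OF m(2)] amb_spaceD(3)[OF m(3)], of d]
    show "x \<otimes>\<^bsub>coord_lie S br\<^esub> (y \<otimes>\<^bsub>coord_lie S br\<^esub> z) \<oplus>\<^bsub>coord_lie S br\<^esub>
         y \<otimes>\<^bsub>coord_lie S br\<^esub> (z \<otimes>\<^bsub>coord_lie S br\<^esub> x) \<oplus>\<^bsub>coord_lie S br\<^esub>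
         z \<otimes>\<^bsub>coord_lie S br\<^esub> (x \<otimes>\<^bsub>coord_lie S br\<^esub> y) = \<zero>\<^bsub>coord_lie S br\<^esub>"
      using * J by (simp add: br cl')
  next
    \<comment> \<open>Intersecting with \<open>S\<close> discards \<open>genM\<close> in the
      kinematical case.\<close>
    define gens where "gens = {genM, genH} \<union> genP ` {..<d} \<union> genK ` {..<d} \<union> (\<lambda>(i, j). genJ i j) ` ({..<d} \<times> {..<d})"
    have "finite (gens \<inter> S)" by (simp add: gens_def)
    moreover have "N = S" if N: "submodule N real_ring (coord_lie S br)" and B: "gens \<inter> S \<subseteq> N" for N
    proof
      show "N \<subseteq> S" using submodule_coord_lie[OF N] by auto
      have SS: "kin_space d \<subseteq> S" using S by (auto simp: kin_space_def)
      show "S \<subseteq> N"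
      proof
        fix x assume "x \<in> S"
        show "x \<in> N"
        proof (rule coord_span[of N d])
          show "mass x = 0 \<or> genM \<in> N"
            using S B \<open>x \<in> S\<close> by (auto simp: kin_space_def gens_def)
          show "x \<in> amb_space d" using S' \<open>x \<in> S\<close> by auto
          have "genH \<in> gens \<inter> S" "i < d \<Longrightarrow> genP i \<in> gens \<inter> S" "i < d \<Longrightarrow> genK i \<in> gens \<inter> S"
            "i < d \<Longrightarrow> j < d \<Longrightarrow> genJ i j \<in> gens \<inter> S" for i j
            using gens_in_kin_space subsetD[OF SS] by (force simp: gens_def)+
          with B show "genH \<in> N" "i < d \<Longrightarrow> genP i \<in> N" "i < d \<Longrightarrow> genK i \<in> N"
            "i < d \<Longrightarrow> j < d \<Longrightarrow> genJ i j \<in> N" for i j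
            by blast+
        qed (use submodule_coord_lie[OF N] in auto)
      qed
    qed
    ultimately show "\<exists>B. finite B \<and> B \<subseteq> carrier (coord_lie S br) \<and>
       (\<forall>N. submodule N real_ring (coord_lie S br) \<longrightarrow> B \<subseteq> N \<longrightarrow> N = carrier (coord_lie S br))"
      by (intro exI[of _ "gens \<inter> S"]) auto
  qed (simp_all add: br cl' S' bracket_bilinear bracket_alternating)
qed

lemma trivial_lift_sel [simp]:
  "KH_P (trivial_lift k) = KH_P k" "KH_K (trivial_lift k) = KH_K k" "HP_P (trivial_lift k) = HP_P k"
  "HP_K (trivial_lift k) = HP_K k" "KP_H (trivial_lift k) = KP_H k" "KP_J (trivial_lift k) = KP_J k"
  "KK_J (trivial_lift k) = KK_J k" "PP_J (trivial_lift k) = PP_J k" "KP_M (trivial_lift k) = 0"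
  "HM_M (trivial_lift k) = 0" "HM_H (trivial_lift k) = 0" "MP_P (trivial_lift k) = 0"
  "MP_K (trivial_lift k) = 0" "MK_P (trivial_lift k) = 0" "MK_K (trivial_lift k) = 0"
  by (simp_all add: trivial_lift_def kin_coeffs.defs amb_coeffs.defs)

lemma kin_bracket_sel [simp]:
  "mass (kin_bracket k d x y) = 0"
  "time (kin_bracket k d x y) = KP_H k * (dot d (boost x) (mom y) - dot d (boost y) (mom x))"
  "mom (kin_bracket k d x y) = (\<lambda>i. matvec d (rot x) (mom y) i - matvec d (rot y) (mom x) i
                 + KH_P k * (boost x i * time y - boost y i * time x)
                 + HP_P k * (time x * mom y i - time y * mom x i))"
  "boost (kin_bracket k d x y) = (\<lambda>i. matvec d (rot x) (boost y) i - matvec d (rot y) (boost x) i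
                 + KH_K k * (boost x i * time y - boost y i * time x)
                 + HP_K k * (time x * mom y i - time y * mom x i))"
  "rot (kin_bracket k d x y) = (\<lambda>i j. matcomm d (rot x) (rot y) i j
                 + KP_J k * (wedge (boost x) (mom y) i j - wedge (boost y) (mom x) i j)
                 + KK_J k * wedge (boost x) (boost y) i j
                 + PP_J k * wedge (mom x) (mom y) i j)"
  by (simp_all add: kin_bracket_def)

text \<open>The kinematical algebra is the mass-zero slice of its trivial lift, so the Jacobi
  identity need not be checked again for it.\<close>

lemma kin_bracket_eq:
  "x \<in> kin_space d \<Longrightarrow> y \<in> kin_space d \<Longrightarrow> kin_bracket k d x y = amb_bracket (trivial_lift k) d x y"
  by (simp add: coords_eq_iff amb_bracket_sel kin_space_def)

lemma kin_bracket_closed: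
  fixes k :: kin_coeffs
  assumes "x \<in> kin_space d" "y \<in> kin_space d" 
  shows "kin_bracket k d x y \<in> kin_space d"
proof -
  have "kin_bracket k d x y \<in> amb_space d"
    unfolding kin_bracket_eq[OF assms] using assms by (intro amb_bracket_closed) (auto simp: kin_space_def)
  then show ?thesis by (simp add: kin_space_def)
qed

lemma isotropy_amb: "isotropy (amb c d) = {x \<in> amb_space d. mass x = 0 \<and> time x = 0 \<and> mom x = (\<lambda>_. 0)}"
  by (simp add: amb_def)

lemma isotropy_kin: "isotropy (kin k d) = {x \<in> amb_space d. mass x = 0 \<and> time x = 0 \<and> mom x = (\<lambda>_. 0)}"
  by (auto simp: kin_def kin_space_def)

lemma submoduleI_coord_lie:
  assumes "czero \<in> S" "\<And>x y. x \<in> S \<Longrightarrow> y \<in> S \<Longrightarrow> cadd x y \<in> S" "\<And>r x. x \<in> S \<Longrightarrow> cscale r x \<in> S"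
    and "N \<subseteq> S" "czero \<in> N" "\<And>x y. x \<in> N \<Longrightarrow> y \<in> N \<Longrightarrow> cadd x y \<in> N" "\<And>r x. x \<in> N \<Longrightarrow> cscale r x \<in> N"
  shows "submodule N real_ring (coord_lie S br)"
proof -
  interpret module real_ring "coord_lie S br"
    by (rule module_coord_lie[OF assms(1-3)])
  show ?thesis
  proof (rule submoduleI)
    fix a assume "a \<in> N"
    then have "cscale (-1) a \<in> N" "a \<in> S" "cscale (-1) a \<in> S" using assms by auto
    moreover have "\<ominus>\<^bsub>coord_lie S br\<^esub> a = cscale (-1) a"
      by (rule M.minus_equality) (use calculation in \<open>simp_all add: coords_eq_iff\<close>)
    ultimately show "\<ominus>\<^bsub>coord_lie S br\<^esub> a \<in> N" by simp
  qed (use assms in auto)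
qed

lemma klein_pair_amb:
  assumes "admissible c" shows "klein_pair (amb c d)"
proof -
  have "submodule (isotropy (amb c d)) real_ring (lie (amb c d))"
    unfolding lie_amb by (rule submoduleI_coord_lie) (auto simp: isotropy_amb amb_space_closed)
  moreover have "x \<otimes>\<^bsub>lie (amb c d)\<^esub> y \<in> isotropy (amb c d)"
    if "x \<in> isotropy (amb c d)" "y \<in> isotropy (amb c d)" for x y
    using that by (auto simp: isotropy_amb amb_bracket_closed amb_bracket_sel)
  ultimately show ?thesis
    unfolding klein_pair_def lie_subalgebra_def
    using lie_algebra_coord_lie[OF assms, of "amb_space d" d] by (auto simp: amb_bracket_closed)
qed

lemma klein_pair_kin:
  assumes "admissible (trivial_lift k)" shows "klein_pair (kin k d)"
proof -
  have "submodule (isotropy (kin k d)) real_ring (lie (kin k d))"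
    unfolding lie_kin by (rule submoduleI_coord_lie) (auto simp: isotropy_kin kin_space_def amb_space_closed)
  moreover have "x \<otimes>\<^bsub>lie (kin k d)\<^esub> y \<in> isotropy (kin k d)"
    if "x \<in> isotropy (kin k d)" "y \<in> isotropy (kin k d)" for x y
    using that kin_bracket_closed[of x d y k] by (auto simp: isotropy_kin kin_space_def)
  ultimately show ?thesis
    unfolding klein_pair_def lie_subalgebra_def
    using lie_algebra_coord_lie[OF assms, of "kin_space d" d "kin_bracket k d"] kin_bracket_closed kin_bracket_eq
    by auto
qed

text \<open>This is the core of effectiveness. Bracketing an element of \<open>K \<oplus> J\<close>
  with \<open>P_j\<close> exposes column \<open>j\<close> of its rotation part in the momentum and,
  if \<open>KP_H k\<close> is non-zero, its boost \<open>j\<close> in the time; bracketing with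
  \<open>H\<close> exposes the boosts if \<open>KH_P k\<close> is non-zero. An ideal inside the
  isotropy admits none of these components.\<close>

lemma isotropy_killed_imp_zero:
  assumes x: "x \<in> amb_space d" "mass x = 0" "time x = 0" "mom x = (\<lambda>_. 0)"
    and k: "KP_H k \<noteq> 0 \<or> KH_P k \<noteq> 0"
    and H: "mom (kin_bracket k d genH x) = (\<lambda>_. 0)"
    and P: "\<And>j. j < d \<Longrightarrow> mom (kin_bracket k d (genP j) x) = (\<lambda>_. 0)"
      "\<And>j. j < d \<Longrightarrow> time (kin_bracket k d (genP j) x) = 0"
  shows "x = czero"
proof -
  have "rot x i j = 0" for i j
  proof (cases "j < d")
    case True
    then show ?thesis using fun_cong[OF P(1)[OF True], of i] by (simp add: x matvec_unit)
  qed (use amb_spaceD(4)[OF x(1)] in auto)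
  moreover have "boost x i = 0" for i
  proof (cases "i < d")
    case True
    then show ?thesis using k fun_cong[OF H, of i] P(2)[OF True]
      by (auto simp: x dot_unit dot_commute[of d "boost x"])
  qed (use amb_spaceD(2)[OF x(1)] in auto)
  ultimately show ?thesis by (simp add: coords_eq_iff x fun_eq_iff)
qed

lemma effective_kin:
  assumes k: "KP_H k \<noteq> 0 \<or> KH_P k \<noteq> 0" shows "effective (kin k d)"
  unfolding effective_def
proof (intro allI impI)
  fix I assume "lie_ideal I (lie (kin k d)) \<and> I \<subseteq> isotropy (kin k d)"
  then have sub: "submodule I real_ring (coord_lie (kin_space d) (kin_bracket k d))"
    and I: "\<And>x y. x \<in> kin_space d \<Longrightarrow> y \<in> I \<Longrightarrow> kin_bracket k d x y \<in> I"
    and iso: "\<And>x. x \<in> I \<Longrightarrow> x \<in> amb_space d \<and> mass x = 0 \<and> time x = 0 \<and> mom x = (\<lambda>_. 0)"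
    by (auto simp: lie_ideal_def isotropy_kin)
  have "x = czero" if "x \<in> I" for x
  proof (rule isotropy_killed_imp_zero[OF _ _ _ _ k])
    show "mom (kin_bracket k d genH x) = (\<lambda>_. 0)"
      using iso I[OF gens_in_kin_space(1) that] by blast
    show "mom (kin_bracket k d (genP j) x) = (\<lambda>_. 0)" "time (kin_bracket k d (genP j) x) = 0" if "j < d" for j
      using iso I[OF gens_in_kin_space(2)[OF that] \<open>x \<in> I\<close>] by blast+
  qed (use iso[OF that] in auto)
  then show "I = {\<zero>\<^bsub>lie (kin k d)\<^esub>}"
    using submodule_coord_lie(2)[OF sub] by auto
qed

lemma effective_amb:
  assumes k: "KP_H c \<noteq> 0 \<or> KH_P c \<noteq> 0" shows "effective (amb c d)"
  unfolding effective_def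
proof (intro allI impI)
  fix I assume "lie_ideal I (lie (amb c d)) \<and> I \<subseteq> isotropy (amb c d)"
  then have sub: "submodule I real_ring (coord_lie (amb_space d) (amb_bracket c d))"
    and I: "\<And>x y. x \<in> amb_space d \<Longrightarrow> y \<in> I \<Longrightarrow> amb_bracket c d x y \<in> I"
    and iso: "\<And>x. x \<in> I \<Longrightarrow> x \<in> amb_space d \<and> mass x = 0 \<and> time x = 0 \<and> mom x = (\<lambda>_. 0)"
    by (auto simp: lie_ideal_def isotropy_amb)
  have *: "mom (kin_bracket c d y x) = (\<lambda>_. 0)" "time (kin_bracket c d y x) = 0"
    if "x \<in> I" "y \<in> amb_space d" "mass y = 0" for x y
    using iso[OF I[OF that(2,1)]] iso[OF that(1)] that(3) by (simp_all add: amb_bracket_sel)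
  have "x = czero" if "x \<in> I" for x
  proof (rule isotropy_killed_imp_zero[OF _ _ _ _ k])
    show "mom (kin_bracket c d genH x) = (\<lambda>_. 0)"
      by (rule *[OF that]) simp_all
    show "mom (kin_bracket c d (genP j) x) = (\<lambda>_. 0)" "time (kin_bracket c d (genP j) x) = 0" if "j < d" for j
      using that by (auto intro!: *[OF \<open>x \<in> I\<close>] simp del: kin_bracket_sel)
  qed (use iso[OF that] in auto)
  then show "I = {\<zero>\<^bsub>lie (amb c d)\<^esub>}"
    using submodule_coord_lie(2)[OF sub] by auto
qed

section \<open>Necessity of the admissibility conditions\<close>

lemma coord_lie_jacobi:
  assumes "lie_algebra (coord_lie S br)" "x \<in> S" "y \<in> S" "z \<in> S"
  shows "cadd (cadd (br x (br y z)) (br y (br z x))) (br z (br x y)) = czero"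
  using lie_algebra.bracket_jacobi[OF assms(1), of x y z] assms(2-) by simp

text \<open>Dimension 2 is the smallest with a non-zero rotation \<open>J_01\<close>, and it already
  yields every condition that \<open>amb_bracket_jacobi\<close> asks for.\<close>

lemma admissibleI:
  assumes L: "lie_algebra (lie (amb c 2))" and I: "lie_ideal span_M (lie (amb c 2))"
  shows "admissible c"
proof -
  have g: "genM \<in> amb_space 2" "genH \<in> amb_space 2" "genP 0 \<in> amb_space 2" "genP 1 \<in> amb_space 2"
    "genK 0 \<in> amb_space 2" "genK 1 \<in> amb_space 2" by simp_all
  note ev = amb_bracket_sel dot_def matvec_def matcomm_def wedge_def numeral_2_eq_2 lessThan_Suc
  note J = coord_lie_jacobi[OF L[unfolded lie_amb]]
  have M: "genM \<in> span_M" unfolding span_M_def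
    by (rule range_eqI[of _ _ 1]) (simp add: coords_eq_iff)
  have "amb_bracket c 2 x genM \<in> span_M" if "x \<in> amb_space 2" for x
    using I that M by (auto simp: lie_ideal_def)
  then have z: "time (amb_bracket c 2 x genM) = 0" "mom (amb_bracket c 2 x genM) 0 = 0" 
    "boost (amb_bracket c 2 x genM) 0 = 0" if "x \<in> amb_space 2" for x
    using that by (fastforce simp: span_M_def)+
  have r: "HM_H c = 0" "MP_P c = 0" "MP_K c = 0" "MK_P c = 0" "MK_K c = 0"
    using z(1)[OF g(2)] z(2,3)[OF g(3)] z(2,3)[OF g(5)] by (simp_all add: ev)
  \<comment> \<open>For \<open>K_0\<close>, \<open>K_1\<close>, \<open>P_1\<close> the bracket
    \<open>[K_1, P_1]\<close> is scalar, while \<open>[K_0, K_1]\<close> and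
    \<open>[K_0, P_1]\<close> are multiples of \<open>J_01\<close>. The components along
    \<open>P_0\<close> and \<open>K_0\<close> therefore compare scalar with rotation
    coefficients.\<close>
  have 1: "KK_J c = KP_H c * KH_P c" "KP_J c = - (KP_H c * KH_K c)"
    using arg_cong[OF J[OF g(5,6,4)], of "\<lambda>x. mom x 0"] arg_cong[OF J[OF g(5,6,4)], of "\<lambda>x. boost x 0"]
    by (simp_all add: ev r algebra_simps)
  \<comment> \<open>The same comparison for \<open>K_0\<close>, \<open>P_0\<close>,
    \<open>P_1\<close>, along \<open>K_1\<close> and \<open>P_1\<close>. The second value of
    \<open>KP_J c\<close> equates \<open>KP_H c * HP_P c\<close> with
    \<open>KP_H c * KH_K c\<close>.\<close>
  have 2: "PP_J c = KP_H c * HP_K c" "KP_J c = - (KP_H c * HP_P c)"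
    using arg_cong[OF J[OF g(5,3,4)], of "\<lambda>x. mom x 1"] arg_cong[OF J[OF g(5,3,4)], of "\<lambda>x. boost x 1"]
    by (simp_all add: ev r algebra_simps)
  have 3: "KP_H c * HM_M c = 0"
    using arg_cong[OF J[OF g(1,5,3)], of mass] by (auto simp: ev r)
  have 4: "KP_M c * (HM_M c + KH_K c - HP_P c) = 0"
    using arg_cong[OF J[OF g(2,5,3)], of mass] by (simp add: ev r algebra_simps)
  show ?thesis
    unfolding admissible_def using r 1 2 3 4 by (auto simp: algebra_simps)
qed

section \<open>Isomorphisms of triplets given by rescaling\<close>

text \<open>Rotations are fixed, and the same numbers act at every index; so the map commutes with
  the action of \<open>J\<close> in every dimension.\<close>

definition rescale :: "real \<Rightarrow> real \<Rightarrow> real \<Rightarrow> real \<Rightarrow> real \<Rightarrow> real \<Rightarrow> coords \<Rightarrow> coords" where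
  "rescale \<mu> n \<tau> s t u x = \<lparr>mass = \<mu> * mass x + n * time x, time = \<tau> * time x, mom = (\<lambda>i. s * mom x i),
     boost = (\<lambda>i. t * boost x i + u * mom x i), rot = rot x\<rparr>"

lemma rescale_sel [simp]:
  "mass (rescale \<mu> n \<tau> s t u x) = \<mu> * mass x + n * time x" "time (rescale \<mu> n \<tau> s t u x) = \<tau> * time x"
  "mom (rescale \<mu> n \<tau> s t u x) = (\<lambda>i. s * mom x i)"
  "boost (rescale \<mu> n \<tau> s t u x) = (\<lambda>i. t * boost x i + u * mom x i)" "rot (rescale \<mu> n \<tau> s t u x) = rot x"
  by (simp_all add: rescale_def)

lemma rescale_inverse:
  assumes "\<mu> \<noteq> 0" "\<tau> \<noteq> 0" "s \<noteq> 0" "t \<noteq> 0"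
  shows "rescale (1 / \<mu>) (- n / (\<mu> * \<tau>)) (1 / \<tau>) (1 / s) (1 / t) (- u / (s * t)) (rescale \<mu> n \<tau> s t u x) = x"
    and "rescale \<mu> n \<tau> s t u (rescale (1 / \<mu>) (- n / (\<mu> * \<tau>)) (1 / \<tau>) (1 / s) (1 / t) (- u / (s * t)) x) = x"
  using assms by (simp_all add: coords_eq_iff fun_eq_iff) (simp_all add: field_simps)

text \<open>
  What \<open>rescale\<close> being a homomorphism from \<open>c\<close> to \<open>c'\<close> imposes on the coefficients not
  involving \<open>M\<close> or \<open>J\<close>; the ones with \<open>J\<close> follow from admissibility.
\<close>

definition kin_related :: "real \<Rightarrow> real \<Rightarrow> real \<Rightarrow> real \<Rightarrow> 'a kin_coeffs_scheme \<Rightarrow> 'b kin_coeffs_scheme \<Rightarrow> bool" where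
  "kin_related \<tau> s t u c c' \<longleftrightarrow>
     KP_H c * \<tau> = KP_H c' * t * s \<and>
     s * KH_P c = KH_P c' * t * \<tau> \<and>
     s * HP_P c = HP_P c' * \<tau> * s - KH_P c' * \<tau> * u \<and>
     t * KH_K c + u * KH_P c = KH_K c' * t * \<tau> \<and>
     t * HP_K c + u * HP_P c = HP_K c' * \<tau> * s - KH_K c' * \<tau> * u"

lemma rescale_bracket:
  assumes nz: "\<tau> \<noteq> 0" "s \<noteq> 0" "t \<noteq> 0"
    and c: "admissible c" and c': "admissible c'"
    and k: "kin_related \<tau> s t u c c'"
    and M: "HM_M c = HM_M c' * \<tau>" "\<mu> * KP_M c + n * KP_H c = KP_M c' * t * s"
  shows "rescale \<mu> n \<tau> s t u (amb_bracket c d x y) =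
    amb_bracket c' d (rescale \<mu> n \<tau> s t u x) (rescale \<mu> n \<tau> s t u y)"
proof -
  have red: "HM_H c = 0" "MP_P c = 0" "MP_K c = 0" "MK_P c = 0" "MK_K c = 0"
    "HM_H c' = 0" "MP_P c' = 0" "MP_K c' = 0" "MK_P c' = 0" "MK_K c' = 0"
    using c c' by (auto simp: admissible_def)
  have k1: "KP_H c = KP_H c' * t * s / \<tau>" and k2: "KH_P c = KH_P c' * t * \<tau> / s"
    and k3: "HP_P c = HP_P c' * \<tau> - KH_P c' * \<tau> * u / s"
    using k nz by (auto simp: kin_related_def field_simps)
  have "t * KH_K c = t * (KH_K c' * \<tau> - u * KH_P c' * \<tau> / s)"
    using k by (simp add: kin_related_def k2 algebra_simps)
  then have k4: "KH_K c = KH_K c' * \<tau> - u * KH_P c' * \<tau> / s"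
    using nz by simp
  have "t * HP_K c = t * (HP_K c' * \<tau> * s / t - KH_K c' * \<tau> * u / t - u * HP_P c' * \<tau> / t + u * u * KH_P c' * \<tau> / (s * t))"
    using k nz by (simp add: kin_related_def k3 algebra_simps)
  then have k5: "HP_K c = HP_K c' * \<tau> * s / t - KH_K c' * \<tau> * u / t - u * HP_P c' * \<tau> / t + u * u * KH_P c' * \<tau> / (s * t)"
    using nz by simp
  have cc: "KK_J c = KP_H c * KH_P c" "KP_J c = - (KP_H c * KH_K c)" "PP_J c = KP_H c * HP_K c"
    "KK_J c' = KP_H c' * KH_P c'" "KP_J c' = - (KP_H c' * KH_K c')" "PP_J c' = KP_H c' * HP_K c'"
    "KP_H c' * HP_P c' = KP_H c' * KH_K c'"
    using c c' by (auto simp: admissible_def algebra_simps)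
  \<comment> \<open>The coefficients \<open>KK_J\<close>, \<open>KP_J\<close>, \<open>PP_J\<close>
    transform as the Gram matrix of a symmetric bilinear form pulled back along \<open>K\<close> to
    \<open>t K\<close>, \<open>P\<close> to \<open>s P + u K\<close>.\<close>
  have J: "KK_J c = KK_J c' * t\<^sup>2" "KP_J c = KP_J c' * t * s + KK_J c' * t * u"
    using nz by (simp_all add: cc(1-6) k1 k2 k3 k4 power2_eq_square field_simps)
  \<comment> \<open>The mixed term of the form arises half from \<open>KH_K c'\<close> and half from
    \<open>HP_P c'\<close>; \<open>cc(7)\<close> identifies the halves, and the brackets expose its
    left side.\<close>
  have "PP_J c = KP_H c' * HP_K c' * s\<^sup>2 - KP_H c' * KH_K c' * u * s - (KP_H c' * HP_P c') * u * s + KP_H c' * KH_P c' * u\<^sup>2"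
    using nz by (simp add: cc(3) k1 k5 power2_eq_square field_simps)
  then have J': "PP_J c = PP_J c' * s\<^sup>2 + 2 * KP_J c' * u * s + KK_J c' * u\<^sup>2"
    unfolding cc(7) by (simp add: cc(4-6) algebra_simps)
  have dc: "dot d (mom y) (mom x) = dot d (mom x) (mom y)" by (rule dot_commute)
  show ?thesis unfolding coords_eq_iff
  proof (intro conjI ext)
    \<comment> \<open>The shear \<open>u\<close> drops out of this pairing because the dot product
      of the two momenta is symmetric; only the factor \<open>t * s\<close> remains.\<close>
    define D where "D = dot d (boost x) (mom y) - dot d (boost y) (mom x)"
    have D: "dot d (\<lambda>i. t * boost x i + u * mom x i) (\<lambda>i. s * mom y i)
        - dot d (\<lambda>i. t * boost y i + u * mom y i) (\<lambda>i. s * mom x i) = t * s * D"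
      by (simp add: D_def lin_simps dc algebra_simps)
    have "(\<mu> * KP_M c + n * KP_H c) * D = KP_M c' * t * s * D" using M(2) by simp
    then show "mass (rescale \<mu> n \<tau> s t u (amb_bracket c d x y)) =
      mass (amb_bracket c' d (rescale \<mu> n \<tau> s t u x) (rescale \<mu> n \<tau> s t u y))"
      by (simp add: amb_bracket_sel red D D_def[symmetric] M(1) algebra_simps)
    show "time (rescale \<mu> n \<tau> s t u (amb_bracket c d x y)) =
      time (amb_bracket c' d (rescale \<mu> n \<tau> s t u x) (rescale \<mu> n \<tau> s t u y))"
      using nz by (simp add: amb_bracket_sel red D D_def[symmetric] k1)
  next
    fix i
    show "mom (rescale \<mu> n \<tau> s t u (amb_bracket c d x y)) i =
      mom (amb_bracket c' d (rescale \<mu> n \<tau> s t u x) (rescale \<mu> n \<tau> s t u y)) i"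
      using nz by (simp add: amb_bracket_sel red lin_simps k2 k3 field_simps)
    show "boost (rescale \<mu> n \<tau> s t u (amb_bracket c d x y)) i =
      boost (amb_bracket c' d (rescale \<mu> n \<tau> s t u x) (rescale \<mu> n \<tau> s t u y)) i"
      using nz by (simp add: amb_bracket_sel red lin_simps k2 k3 k4 k5 field_simps)
  next
    fix i j
    show "rot (rescale \<mu> n \<tau> s t u (amb_bracket c d x y)) i j =
      rot (amb_bracket c' d (rescale \<mu> n \<tau> s t u x) (rescale \<mu> n \<tau> s t u y)) i j"
      by (simp add: amb_bracket_sel J J' wedge_def power2_eq_square algebra_simps)
  qed
qed

lemma rescale_in_space:
  assumes "x \<in> amb_space d" shows "rescale \<mu> n \<tau> s t u x \<in> amb_space d"
proof (rule amb_spaceI)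
  show "rot (rescale \<mu> n \<tau> s t u x) i j = - rot (rescale \<mu> n \<tau> s t u x) j i" for i j
    using amb_spaceD(3)[OF assms, of i j] by simp
qed (use amb_spaceD(1,2,4)[OF assms] in auto)

lemma image_eq_of_inverse:
  assumes "\<And>x. x \<in> A \<Longrightarrow> f x \<in> B" "\<And>y. y \<in> B \<Longrightarrow> g y \<in> A" "\<And>y. f (g y) = y"
  shows "f ` A = B"
  using assms by (metis image_eqI image_subsetI subsetI subset_antisym)

lemma amb_sel:
  "rotations (amb c d) = {x \<in> amb_space d. mass x = 0 \<and> time x = 0 \<and> mom x = (\<lambda>_. 0) \<and> boost x = (\<lambda>_. 0)}"
  "scalars (amb c d) = {x \<in> amb_space d. mom x = (\<lambda>_. 0) \<and> boost x = (\<lambda>_. 0) \<and> rot x = (\<lambda>_ _. 0)}"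
  "vectors (amb c d) = {x \<in> amb_space d. mass x = 0 \<and> time x = 0 \<and> rot x = (\<lambda>_ _. 0)}"
  by (simp_all add: amb_def)

lemma kin_sel:
  "isotropy (kin c d) = {x \<in> kin_space d. time x = 0 \<and> mom x = (\<lambda>_. 0)}"
  "rotations (kin c d) = {x \<in> kin_space d. time x = 0 \<and> mom x = (\<lambda>_. 0) \<and> boost x = (\<lambda>_. 0)}"
  "scalars (kin c d) = {x \<in> kin_space d. mom x = (\<lambda>_. 0) \<and> boost x = (\<lambda>_. 0) \<and> rot x = (\<lambda>_ _. 0)}"
  "vectors (kin c d) = {x \<in> kin_space d. time x = 0 \<and> rot x = (\<lambda>_ _. 0)}"
  by (simp_all add: kin_def)

lemma lie_isoI:
  assumes "\<And>x y. x \<in> S \<Longrightarrow> y \<in> S \<Longrightarrow> f (cadd x y) = f x \<oplus>\<^bsub>L\<^esub> f y"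
    and "\<And>r x. x \<in> S \<Longrightarrow> f (cscale r x) = r \<odot>\<^bsub>L\<^esub> f x"
    and "\<And>x y. x \<in> S \<Longrightarrow> y \<in> S \<Longrightarrow> f (br x y) = f x \<otimes>\<^bsub>L\<^esub> f y"
    and "bij_betw f S (carrier L)"
  shows "f \<in> lie_iso (coord_lie S br) L"
  using assms bij_betw_imp_surj_on[OF assms(4)] by (auto simp: lie_iso_def iso_def hom_def)

lemma span_M_iff: "x \<in> span_M \<longleftrightarrow> time x = 0 \<and> mom x = (\<lambda>_. 0) \<and> boost x = (\<lambda>_. 0) \<and> rot x = (\<lambda>_ _. 0)"
proof
  assume "time x = 0 \<and> mom x = (\<lambda>_. 0) \<and> boost x = (\<lambda>_. 0) \<and> rot x = (\<lambda>_ _. 0)"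
  then show "x \<in> span_M"
    unfolding span_M_def by (intro range_eqI[of _ _ "mass x"]) (simp add: coords_eq_iff)
qed (auto simp: span_M_def)

lemma triplet_isomorphic_rescale:
  assumes nz: "\<mu> \<noteq> 0" "\<tau> \<noteq> 0" "s \<noteq> 0" "t \<noteq> 0"
    and c: "admissible c" and c': "admissible c'"
    and k: "kin_related \<tau> s t u c c'"
    and M: "HM_M c = HM_M c' * \<tau>" "\<mu> * KP_M c + n * KP_H c = KP_M c' * t * s"
  shows "triplet_isomorphic (amb c d, span_M) (amb c' d, span_M)"
proof -
  let ?f = "rescale \<mu> n \<tau> s t u"
  let ?g = "rescale (1 / \<mu>) (- n / (\<mu> * \<tau>)) (1 / \<tau>) (1 / s) (1 / t) (- u / (s * t))"
  note inv = rescale_inverse[OF nz, of n u]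
  \<comment> \<open>The distinguished subspaces depend on no coefficients, and the inverse is again
    a \<open>rescale\<close>; so invariance under both maps is enough.\<close>
  have im: "?f ` A = A" if "\<And>x. x \<in> A \<Longrightarrow> ?f x \<in> A" "\<And>x. x \<in> A \<Longrightarrow> ?g x \<in> A" for A
    by (rule image_eq_of_inverse[of _ _ _ ?g]) (use that inv in auto)
  have "inj ?f" using inv(1) by (metis injI)
  moreover have sp: "?f ` amb_space d = amb_space d"
    by (rule im) (simp_all add: rescale_in_space)
  ultimately have "bij_betw ?f (amb_space d) (amb_space d)"
    by (auto simp: bij_betw_def intro: inj_on_subset)
  then have "?f \<in> lie_iso (coord_lie (amb_space d) (amb_bracket c d)) (coord_lie (amb_space d) (amb_bracket c' d))"
    by (intro lie_isoI)
       (use rescale_bracket[OF nz(2-4) c c' k M] in \<open>auto simp: coords_eq_iff algebra_simps\<close>)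
  moreover have "?f ` isotropy (amb c d) = isotropy (amb c' d)"
    unfolding isotropy_amb by (rule im) (auto intro: rescale_in_space)
  moreover have "?f ` rotations (amb c d) = rotations (amb c' d)"
    unfolding amb_sel by (rule im) (auto intro: rescale_in_space)
  moreover have "?f ` scalars (amb c d) = scalars (amb c' d)"
    unfolding amb_sel by (rule im) (auto intro: rescale_in_space)
  moreover have "?f ` vectors (amb c d) = vectors (amb c' d)"
    unfolding amb_sel by (rule im) (auto intro: rescale_in_space)
  moreover have "?f ` span_M = span_M"
    by (rule im) (auto simp: span_M_iff)
  ultimately show ?thesis
    unfolding triplet_isomorphic_def klein_iso_def by auto
qed

section \<open>The quotient by the span of \<open>M\<close>\<close>

text \<open>The coset of \<open>span_M\<close> through \<open>x\<close>, described by the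
  coordinates that survive in the quotient.\<close>

definition fibre :: "coords \<Rightarrow> coords set" where
  "fibre x = {y. time y = time x \<and> mom y = mom x \<and> boost y = boost x \<and> rot y = rot x}"

lemma coset_span_M: "span_M +>\<^bsub>coord_lie S br\<^esub> x = fibre x"
proof -
  have "fibre x \<subseteq> (\<Union>h\<in>span_M. {cadd h x})"
  proof
    fix y assume "y \<in> fibre x"
    then have "y = cadd (cscale (mass y - mass x) genM) x" by (simp add: fibre_def coords_eq_iff)
    then show "y \<in> (\<Union>h\<in>span_M. {cadd h x})" by (auto simp: span_M_def)
  qed
  moreover have "(\<Union>h\<in>span_M. {cadd h x}) \<subseteq> fibre x"
    by (auto simp: span_M_def fibre_def)
  ultimately show ?thesis by (auto simp: a_r_coset_def r_coset_def)
qed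

lemma fibre_eq_iff: "fibre x = fibre y \<longleftrightarrow> time x = time y \<and> mom x = mom y \<and> boost x = boost y \<and> rot x = rot y"
  unfolding fibre_def by (auto simp: set_eq_iff)

lemma fibre_self: "x \<in> fibre x" by (simp add: fibre_def)

text \<open>Operations in the quotient are unions over all representatives; such a union collapses
  once each representative gives the same coset.\<close>

lemma UN_fibre:
  assumes "x \<in> A" "\<And>y. y \<in> A \<Longrightarrow> fibre (F y) = fibre (F x)"
  shows "(\<Union>y\<in>A. fibre (F y)) = fibre (F x)"
proof -
  have "(\<Union>y\<in>A. fibre (F y)) = (\<Union>y\<in>A. fibre (F x))"
    using assms(2) by simp
  then show ?thesis using assms(1) by auto
qed

lemma a_rcosets_eq_image: "a_rcosets\<^bsub>L\<^esub> I = (\<lambda>x. I +>\<^bsub>L\<^esub> x) ` carrier L"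
  unfolding A_RCOSETS_def RCOSETS_def a_r_coset_def by auto

lemma klein_quotient_sel:
  "carrier (lie (klein_quotient (amb c d) span_M)) = fibre ` amb_space d"
  "\<zero>\<^bsub>lie (klein_quotient (amb c d) span_M)\<^esub> = span_M"
  "isotropy (klein_quotient (amb c d) span_M) = fibre ` isotropy (amb c d)"
  "rotations (klein_quotient (amb c d) span_M) = fibre ` rotations (amb c d)"
  "scalars (klein_quotient (amb c d) span_M) = fibre ` scalars (amb c d)"
  "vectors (klein_quotient (amb c d) span_M) = fibre ` vectors (amb c d)"
  by (auto simp: klein_quotient_def Let_def lie_quotient_def ring.defs module.defs FactRing_def coset_span_M a_rcosets_eq_image)

text \<open>The vanishing coefficients ensure that altering the mass of an argument alters only the
  mass of the bracket, so the choice of representatives is immaterial.\<close>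

lemma klein_quotient_ops:
  assumes c: "HM_H c = 0" "MP_P c = 0" "MP_K c = 0" "MK_P c = 0" "MK_K c = 0"
  shows "fibre x \<oplus>\<^bsub>lie (klein_quotient (amb c d) span_M)\<^esub> fibre y = fibre (cadd x y)"
    and "fibre x \<otimes>\<^bsub>lie (klein_quotient (amb c d) span_M)\<^esub> fibre y = fibre (amb_bracket c d x y)"
    and "r \<odot>\<^bsub>lie (klein_quotient (amb c d) span_M)\<^esub> fibre x = fibre (cscale r x)"
proof -
  have "fibre x <+>\<^bsub>coord_lie (amb_space d) (amb_bracket c d)\<^esub> fibre y = fibre (cadd x y)"
  proof -
    have "fibre x <+>\<^bsub>coord_lie (amb_space d) (amb_bracket c d)\<^esub> fibre y = (\<Union>a\<in>fibre x. \<Union>b\<in>fibre y. {cadd a b})"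
      by (simp add: set_add_def set_mult_def)
    also have "\<dots> = fibre (cadd x y)"
    proof
      show "fibre (cadd x y) \<subseteq> (\<Union>a\<in>fibre x. \<Union>b\<in>fibre y. {cadd a b})"
      proof
        fix z assume z: "z \<in> fibre (cadd x y)"
        \<comment> \<open>The representative of the second coset absorbs the whole discrepancy in
          mass.\<close>
        let ?b = "y\<lparr>mass := mass z - mass x\<rparr>"
        have "?b \<in> fibre y" "z = cadd x ?b"
          using z by (simp_all add: fibre_def coords_eq_iff)
        then show "z \<in> (\<Union>a\<in>fibre x. \<Union>b\<in>fibre y. {cadd a b})" using fibre_self[of x] by blast
      qed
    qed (auto simp: fibre_def)
    finally show ?thesis .
  qed
  then show "fibre x \<oplus>\<^bsub>lie (klein_quotient (amb c d) span_M)\<^esub> fibre y = fibre (cadd x y)"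
    by (simp add: klein_quotient_def Let_def lie_quotient_def ring.defs module.defs FactRing_def)
  have "(\<Union>a\<in>fibre x. \<Union>b\<in>fibre y. fibre (amb_bracket c d a b)) = (\<Union>a\<in>fibre x. fibre (amb_bracket c d a y))"
    by (intro SUP_cong refl UN_fibre fibre_self)
       (simp add: fibre_eq_iff amb_bracket_sel c, simp add: fibre_def)
  also have "\<dots> = fibre (amb_bracket c d x y)"
    by (intro UN_fibre fibre_self) (simp add: fibre_eq_iff amb_bracket_sel c, simp add: fibre_def)
  finally show "fibre x \<otimes>\<^bsub>lie (klein_quotient (amb c d) span_M)\<^esub> fibre y = fibre (amb_bracket c d x y)"
    by (simp add: klein_quotient_def Let_def lie_quotient_def ring.defs module.defs FactRing_def rcoset_mult_def coset_span_M)
  have "(\<Union>a\<in>fibre x. fibre (cscale r a)) = fibre (cscale r x)"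
    by (intro UN_fibre fibre_self) (simp add: fibre_eq_iff, simp add: fibre_def)
  then show "r \<odot>\<^bsub>lie (klein_quotient (amb c d) span_M)\<^esub> fibre x = fibre (cscale r x)"
    by (simp add: klein_quotient_def Let_def lie_quotient_def ring.defs module.defs coset_span_M)
qed

lemma fibre_image_kin:
  assumes pr: "\<And>x. pr x \<Longrightarrow> pr' (x\<lparr>mass := 0\<rparr>)" "\<And>x. x \<in> kin_space d \<Longrightarrow> pr' x \<Longrightarrow> pr x"
  shows "fibre ` {x \<in> amb_space d. pr x} = fibre ` {x \<in> kin_space d. pr' x}"
proof
  show "fibre ` {x \<in> kin_space d. pr' x} \<subseteq> fibre ` {x \<in> amb_space d. pr x}"
    using pr(2) by (auto simp: kin_space_def)
  show "fibre ` {x \<in> amb_space d. pr x} \<subseteq> fibre ` {x \<in> kin_space d. pr' x}"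
  proof
    fix Z assume "Z \<in> fibre ` {x \<in> amb_space d. pr x}"
    then obtain x where x: "Z = fibre x" "x \<in> amb_space d" "pr x" by auto
    have "x\<lparr>mass := 0\<rparr> \<in> amb_space d"
    proof (rule amb_spaceI)
      show "rot (x\<lparr>mass := 0\<rparr>) i j = - rot (x\<lparr>mass := 0\<rparr>) j i" for i j
        using amb_spaceD(3)[OF x(2), of i j] by simp
    qed (use amb_spaceD(1,2,4)[OF x(2)] in auto)
    then have "x\<lparr>mass := 0\<rparr> \<in> kin_space d"
      by (simp add: kin_space_def)
    moreover have "Z = fibre (x\<lparr>mass := 0\<rparr>)" using x(1) by (simp add: fibre_eq_iff)
    ultimately show "Z \<in> fibre ` {x \<in> kin_space d. pr' x}" using x(3) pr(1) by blast
  qed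
qed

text \<open>A coset contains exactly one element of mass zero, and modulo \<open>M\<close> the
  ambient bracket is the kinematical one. Questions about the quotient thus become questions about
  explicit coordinates.\<close>

lemma fibre_klein_iso:
  fixes c :: amb_coeffs
  assumes c: "HM_H c = 0" "MP_P c = 0" "MP_K c = 0" "MK_P c = 0" "MK_K c = 0"
  shows "fibre \<in> klein_iso (kin (kin_coeffs.truncate c) d) (klein_quotient (amb c d) span_M)"
proof -
  let ?k = "kin_coeffs.truncate c"
  have sp: "fibre ` amb_space d = fibre ` kin_space d"
    using fibre_image_kin[of "\<lambda>_. True" "\<lambda>_. True" d] by simp
  have "inj_on fibre (kin_space d)"
    by (auto simp: inj_on_def fibre_eq_iff coords_eq_iff kin_space_def)
  then have "bij_betw fibre (kin_space d) (carrier (lie (klein_quotient (amb c d) span_M)))"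
    by (simp add: klein_quotient_sel sp bij_betw_def)
  moreover have "fibre (kin_bracket ?k d x y) = fibre (amb_bracket c d x y)"
    if "x \<in> kin_space d" "y \<in> kin_space d" for x y
    using that by (simp add: fibre_eq_iff amb_bracket_sel c kin_space_def kin_coeffs.truncate_def)
  ultimately have "fibre \<in> lie_iso (lie (kin ?k d)) (lie (klein_quotient (amb c d) span_M))"
    unfolding lie_kin by (intro lie_isoI) (simp_all add: klein_quotient_ops[OF c])
  then show ?thesis
    unfolding klein_iso_def klein_quotient_sel
    by (auto simp: isotropy_amb amb_sel kin_sel intro!: fibre_image_kin[symmetric] simp del: lie_kin) (simp_all add: kin_space_def)
qed

section \<open>Inverses and transport of structure\<close>

lemma lie_isoD:
  assumes "f \<in> lie_iso L L'"
  shows "x \<in> carrier L \<Longrightarrow> f x \<in> carrier L'"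
    "x \<in> carrier L \<Longrightarrow> y \<in> carrier L \<Longrightarrow> f (x \<oplus>\<^bsub>L\<^esub> y) = f x \<oplus>\<^bsub>L'\<^esub> f y"
    "x \<in> carrier L \<Longrightarrow> f (r \<odot>\<^bsub>L\<^esub> x) = r \<odot>\<^bsub>L'\<^esub> f x"
    "x \<in> carrier L \<Longrightarrow> y \<in> carrier L \<Longrightarrow> f (x \<otimes>\<^bsub>L\<^esub> y) = f x \<otimes>\<^bsub>L'\<^esub> f y"
    "bij_betw f (carrier L) (carrier L')"
  using assms by (auto simp: lie_iso_def iso_def hom_def)

lemma lie_iso_inv:
  assumes f: "f \<in> lie_iso L L'" and L: "lie_algebra L"
  shows "inv_into (carrier L) f \<in> lie_iso L' L"
proof -
  interpret lie_algebra L by fact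
  let ?g = "inv_into (carrier L) f"
  note fD = lie_isoD[OF f]
  have bij: "bij_betw ?g (carrier L') (carrier L)"
    using fD(5) by (rule bij_betw_inv_into)
  have g: "?g y \<in> carrier L" "f (?g y) = y" if "y \<in> carrier L'" for y
    using that fD(5) bij_betwE[OF bij] bij_betw_inv_into_right by fastforce+
  have inv: "?g (f x) = x" if "x \<in> carrier L" for x
    using that fD(5) bij_betw_inv_into_left by fastforce
  have "?g (x \<oplus>\<^bsub>L'\<^esub> y) = ?g x \<oplus>\<^bsub>L\<^esub> ?g y" "?g (x \<otimes>\<^bsub>L'\<^esub> y) = ?g x \<otimes>\<^bsub>L\<^esub> ?g y"
    if "x \<in> carrier L'" "y \<in> carrier L'" for x y
    using inv[of "?g x \<oplus>\<^bsub>L\<^esub> ?g y"] inv[of "?g x \<otimes>\<^bsub>L\<^esub> ?g y"] g that fD(2,4) bracket_closed by auto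
  moreover have "?g (r \<odot>\<^bsub>L'\<^esub> x) = r \<odot>\<^bsub>L\<^esub> ?g x" if "x \<in> carrier L'" for r x
    using inv[of "r \<odot>\<^bsub>L\<^esub> ?g x"] g that fD(3) by auto
  ultimately show ?thesis
    using bij bij_betwE[OF bij] by (auto simp: lie_iso_def iso_def hom_def)
qed

lemma lie_iso_comp:
  assumes f: "f \<in> lie_iso L L'" and g: "g \<in> lie_iso L' L''"
  shows "g \<circ> f \<in> lie_iso L L''"
  using lie_isoD[OF f] lie_isoD[OF g] bij_betw_trans[OF lie_isoD(5)[OF f] lie_isoD(5)[OF g]]
  by (auto simp: lie_iso_def iso_def hom_def)

lemma klein_iso_comp:
  assumes "f \<in> klein_iso A B" "g \<in> klein_iso B C"
  shows "g \<circ> f \<in> klein_iso A C"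
  unfolding klein_iso_def mem_Collect_eq image_comp[symmetric]
  using assms lie_iso_comp[of f "lie A" "lie B" g "lie C"] by (simp add: klein_iso_def)

text \<open>The inclusions allow \<open>inv_into\<close> on the carrier to carry images of these
  subsets back.\<close>

definition klein_wf :: "'a klein \<Rightarrow> bool" where
  "klein_wf A \<longleftrightarrow> lie_algebra (lie A) \<and> isotropy A \<subseteq> carrier (lie A) \<and> rotations A \<subseteq> carrier (lie A) \<and>
     scalars A \<subseteq> carrier (lie A) \<and> vectors A \<subseteq> carrier (lie A)"

lemma klein_iso_inv:
  assumes "f \<in> klein_iso A B" and A: "klein_wf A"
  shows "inv_into (carrier (lie A)) f \<in> klein_iso B A"
proof -
  have f: "f \<in> lie_iso (lie A) (lie B)" using assms by (simp add: klein_iso_def)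
  have im: "f ` isotropy A = isotropy B" "f ` rotations A = rotations B"
    "f ` scalars A = scalars B" "f ` vectors A = vectors B"
    using assms by (simp_all add: klein_iso_def)
  from f have inj: "inj_on f (carrier (lie A))" using lie_isoD(5) bij_betw_imp_inj_on by blast
  show ?thesis
    using A lie_iso_inv[OF f] inv_into_image_cancel[OF inj]
    by (simp add: klein_iso_def klein_wf_def im[symmetric])
qed

lemma klein_wf_amb: "admissible c \<Longrightarrow> klein_wf (amb c d)"
  using klein_pair_amb[of c d] unfolding klein_wf_def
  by (auto simp: klein_pair_def isotropy_amb amb_sel)

lemma klein_wf_kin: "admissible (trivial_lift k) \<Longrightarrow> klein_wf (kin k d)"
  using klein_pair_kin[of k d] unfolding klein_wf_def
  by (auto simp: klein_pair_def kin_sel)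

lemma span_M_subset: "span_M \<subseteq> amb_space d"
  using amb_space_closed(3)[OF gens_in_space(1)] by (auto simp: span_M_def)

lemma triplet_isomorphic_sym:
  assumes "triplet_isomorphic (amb c d, span_M) (amb c' d, span_M)" and c: "admissible c"
  shows "triplet_isomorphic (amb c' d, span_M) (amb c d, span_M)"
proof -
  obtain f where f: "f \<in> klein_iso (amb c d) (amb c' d)" "f ` span_M = span_M"
    using assms by (auto simp: triplet_isomorphic_def)
  then have "inj_on f (amb_space d)"
    using lie_isoD(5)[of f "lie (amb c d)" "lie (amb c' d)"] by (auto simp: klein_iso_def bij_betw_def)
  then have "inv_into (amb_space d) f ` span_M = span_M"
    using inv_into_image_cancel[OF _ span_M_subset] f(2) by metis
  moreover have "inv_into (amb_space d) f \<in> klein_iso (amb c' d) (amb c d)"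
    using klein_iso_inv[OF f(1) klein_wf_amb[OF c]] by simp
  ultimately show ?thesis by (auto simp: triplet_isomorphic_def)
qed

lemma submodule_preimage:
  assumes f: "f \<in> lie_iso L L'" and L: "module real_ring L" and L': "module real_ring L'"
    and N: "submodule N real_ring L'"
  shows "submodule {x \<in> carrier L. f x \<in> N} real_ring L"
proof -
  interpret module real_ring L by fact
  interpret L': module real_ring L' by fact
  note fD = lie_isoD[OF f]
  interpret N: submodule N real_ring L' by fact
  have "f \<zero>\<^bsub>L\<^esub> \<oplus>\<^bsub>L'\<^esub> f \<zero>\<^bsub>L\<^esub> = f \<zero>\<^bsub>L\<^esub>"
    using fD(2)[of "\<zero>\<^bsub>L\<^esub>" "\<zero>\<^bsub>L\<^esub>"] by simp
  then have z: "f \<zero>\<^bsub>L\<^esub> = \<zero>\<^bsub>L'\<^esub>"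
    using fD(1)[OF M.zero_closed] by (simp add: L'.M.add.l_cancel_one)
  have neg: "f (\<ominus>\<^bsub>L\<^esub> x) = \<ominus>\<^bsub>L'\<^esub> f x" if "x \<in> carrier L" for x
    by (rule L'.M.minus_equality[symmetric])
       (use that in \<open>simp_all add: fD(1) fD(2)[symmetric] z M.l_neg\<close>)
  show ?thesis
    by (rule submoduleI)
       (use N.one_closed N.m_closed N.smult_closed L'.submoduleE(3)[OF N] in \<open>auto simp: fD(2,3) neg z\<close>)
qed

text \<open>The record \<open>L'\<close> is not yet known to be a group, and \<open>lie_iso\<close>
  does not mention its field \<open>zero\<close>; hence the hypothesis fixing that field.\<close>

lemma lie_algebra_transport:
  assumes f: "f \<in> lie_iso L L'" and L: "lie_algebra L" and z: "\<zero>\<^bsub>L'\<^esub> = f \<zero>\<^bsub>L\<^esub>"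
  shows "lie_algebra L'"
proof -
  interpret lie_algebra L by fact
  note fD = lie_isoD[OF f]
  have surj: "\<exists>x\<in>carrier L. y = f x" if "y \<in> carrier L'" for y
    using that bij_betw_imp_surj_on[OF fD(5)] by blast
  note D = fD(1) fD(2-4)[symmetric] bracket_closed
  have "abelian_group L'"
  proof (rule abelian_groupI)
    fix y assume "y \<in> carrier L'"
    then obtain x where x: "x \<in> carrier L" "y = f x" using surj by blast
    then show "\<exists>y'\<in>carrier L'. y' \<oplus>\<^bsub>L'\<^esub> y = \<zero>\<^bsub>L'\<^esub>"
      by (intro bexI[of _ "f (\<ominus>\<^bsub>L\<^esub> x)"]) (simp_all add: D z M.l_neg)
  next
    fix x y assume "x \<in> carrier L'" "y \<in> carrier L'"
    then obtain x' y' where "x' \<in> carrier L" "y' \<in> carrier L" "x = f x'" "y = f y'"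
      using surj by meson
    then show "x \<oplus>\<^bsub>L'\<^esub> y = y \<oplus>\<^bsub>L'\<^esub> x"
      by (simp add: D M.a_comm)
  qed (auto dest!: surj simp: D z M.a_assoc)
  then interpret L': module real_ring L'
    by (intro moduleI)
       (use R.is_cring in \<open>auto dest!: surj simp: D smult_l_distr[simplified] smult_r_distr[simplified] smult_assoc1[simplified]
         smult_one[simplified] smult_closed[simplified]\<close>)
  show ?thesis
  proof
    obtain B where B: "finite B" "B \<subseteq> carrier L"
      "\<And>N. submodule N real_ring L \<Longrightarrow> B \<subseteq> N \<Longrightarrow> N = carrier L"
      using finite_dimensional by blast
    \<comment> \<open>The images of generators generate: a submodule containing them has a preimage
      containing the generators.\<close>
    have "N = carrier L'" if N: "submodule N real_ring L'" and BN: "f ` B \<subseteq> N" for N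
    proof -
      have "submodule {x \<in> carrier L. f x \<in> N} real_ring L"
        by (rule submodule_preimage[OF f _ _ N]) unfold_locales
      moreover have "B \<subseteq> {x \<in> carrier L. f x \<in> N}" using B(2) BN by auto
      ultimately have "{x \<in> carrier L. f x \<in> N} = carrier L" by (rule B(3))
      then have "y \<in> N" if "y \<in> carrier L'" for y
        using surj[OF that] by blast
      then show ?thesis using L'.submoduleE(1)[OF N] by blast
    qed
    then show "\<exists>B. finite B \<and> B \<subseteq> carrier L' \<and> (\<forall>N. submodule N real_ring L' \<longrightarrow> B \<subseteq> N \<longrightarrow> N = carrier L')"
      using B(1,2) fD(1) by (intro exI[of _ "f ` B"]) auto
  qed (auto dest!: surj simp: D bracket_add_left bracket_add_right bracket_smult_left bracket_smult_right
       bracket_alternating bracket_jacobi z smult_closed[simplified])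
qed

text \<open>This carries the properties of the explicit pair \<open>kin\<close> over to the quotient
  along \<open>fibre\<close>.\<close>

lemma klein_pair_effective_transport:
  assumes f: "f \<in> klein_iso A B" and A: "klein_pair A" and eff: "effective A" and z: "\<zero>\<^bsub>lie B\<^esub> = f \<zero>\<^bsub>lie A\<^esub>"
  shows "klein_pair B" "effective B"
proof -
  have fl: "f \<in> lie_iso (lie A) (lie B)" and fi: "f ` isotropy A = isotropy B"
    using f by (auto simp: klein_iso_def)
  note fD = lie_isoD[OF fl]
  have LA: "lie_algebra (lie A)" and sub: "submodule (isotropy A) real_ring (lie A)"
    and br: "\<And>x y. x \<in> isotropy A \<Longrightarrow> y \<in> isotropy A \<Longrightarrow> x \<otimes>\<^bsub>lie A\<^esub> y \<in> isotropy A"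
    using A by (auto simp: klein_pair_def lie_subalgebra_def)
  have LB: "lie_algebra (lie B)" by (rule lie_algebra_transport[OF fl LA z])
  interpret B: lie_algebra "lie B" by fact
  interpret A: lie_algebra "lie A" by fact
  have isoA: "isotropy A \<subseteq> carrier (lie A)" using A.submoduleE(1)[OF sub] .
  let ?g = "inv_into (carrier (lie A)) f"
  have g: "?g \<in> lie_iso (lie B) (lie A)" by (rule lie_iso_inv[OF fl LA])
  have inj: "inj_on f (carrier (lie A))" and surj: "f ` carrier (lie A) = carrier (lie B)"
    using fD(5) by (auto simp: bij_betw_def)
  \<comment> \<open>The image is rewritten as a preimage under the inverse, so that
    \<open>submodule_preimage\<close> applies.\<close>
  have "{y \<in> carrier (lie B). ?g y \<in> isotropy A} = isotropy B"
    using isoA inj surj by (force simp: fi[symmetric] inv_into_f_f)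
  then have subB: "submodule (isotropy B) real_ring (lie B)"
    using submodule_preimage[OF g B.module_axioms A.module_axioms sub] by simp
  have "x \<otimes>\<^bsub>lie B\<^esub> y \<in> isotropy B" if "x \<in> isotropy B" "y \<in> isotropy B" for x y
  proof -
    from that obtain x' y' where xy: "x' \<in> isotropy A" "y' \<in> isotropy A" "x = f x'" "y = f y'"
      unfolding fi[symmetric] by (auto elim!: imageE)
    then have "x \<otimes>\<^bsub>lie B\<^esub> y = f (x' \<otimes>\<^bsub>lie A\<^esub> y')"
      using fD(4)[OF subsetD[OF isoA xy(1)] subsetD[OF isoA xy(2)]] by simp
    then show ?thesis using br[OF xy(1,2)] unfolding fi[symmetric] by simp
  qed
  then show "klein_pair B" using LB subB by (simp add: klein_pair_def lie_subalgebra_def)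
  show "effective B"
    unfolding effective_def
  proof (intro allI impI)
    fix I assume I: "lie_ideal I (lie B) \<and> I \<subseteq> isotropy B"
    let ?N = "{x \<in> carrier (lie A). f x \<in> I}"
    have "submodule ?N real_ring (lie A)"
      using I by (intro submodule_preimage[OF fl A.module_axioms B.module_axioms]) (simp add: lie_ideal_def)
    moreover have "x \<otimes>\<^bsub>lie A\<^esub> y \<in> ?N" if "x \<in> carrier (lie A)" "y \<in> ?N" for x y
      using that I fD(1,4) A.bracket_closed by (auto simp: lie_ideal_def)
    ultimately have "lie_ideal ?N (lie A)" by (simp add: lie_ideal_def)
    moreover have "?N \<subseteq> isotropy A"
    proof
      fix x assume x: "x \<in> ?N"
      then obtain y where "y \<in> isotropy A" "f x = f y" using I fi by blast
      then show "x \<in> isotropy A" using x isoA inj by (auto dest: inj_onD)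
    qed
    ultimately have N: "?N = {\<zero>\<^bsub>lie A\<^esub>}" using eff by (simp add: effective_def)
    have "I \<subseteq> carrier (lie B)"
      using I fD(1) isoA unfolding fi[symmetric] by blast
    then have "I \<subseteq> f ` carrier (lie A)" by (simp add: surj)
    then have "I = f ` ?N" by blast
    then show "I = {\<zero>\<^bsub>lie B\<^esub>}" using N z by simp
  qed
qed

section \<open>Isomorphisms in dimension one\<close>

lemma cscale_0: "cscale 0 x = czero"
  by (simp add: coords_eq_iff)

lemma lie_iso_czero:
  assumes "f \<in> lie_iso (coord_lie S br) (coord_lie S' br')" "czero \<in> S"
  shows "f czero = czero"
  using lie_isoD(3)[OF assms(1), of czero 0] assms(2) by (simp add: cscale_0)

text \<open>
  Applied to both \<open>amb\<close> and \<open>kin\<close>; since \<open>genM\<close> does not lie in \<open>kin_space\<close>, the hypotheses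
  mention only the multiple of it that occurs in \<open>[K, P]\<close>.
\<close>

lemma lie_iso_params:
  assumes S: "S = amb_space 1 \<or> S = kin_space 1"
    and f: "f \<in> lie_iso (coord_lie S br) (coord_lie S br')"
    and br: "\<And>x y. x \<in> S \<Longrightarrow> y \<in> S \<Longrightarrow> br x y = amb_bracket c 1 x y"
      "\<And>x y. x \<in> S \<Longrightarrow> y \<in> S \<Longrightarrow> br' x y = amb_bracket c' 1 x y"
    and c': "HM_H c' = 0" "MP_P c' = 0" "MP_K c' = 0" "MK_P c' = 0" "MK_K c' = 0"
    and M: "cscale (KP_M c) genM \<in> S" "f (cscale (KP_M c) genM) \<in> span_M"
    and H: "mom (f genH) = (\<lambda>_. 0)" "boost (f genH) = (\<lambda>_. 0)" "rot (f genH) = (\<lambda>_ _. 0)" "mass (f genH) = n"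
    and K: "mass (f (genK 0)) = 0" "time (f (genK 0)) = 0" "mom (f (genK 0)) = (\<lambda>_. 0)" "rot (f (genK 0)) = (\<lambda>_ _. 0)"
    and P: "mass (f (genP 0)) = 0" "time (f (genP 0)) = 0" "rot (f (genP 0)) = (\<lambda>_ _. 0)"
    and Hz: "time (f genH) \<noteq> 0"
  obtains \<tau> s t u where "\<tau> \<noteq> 0" "s \<noteq> 0" "t \<noteq> 0"
    "f genH = cadd (cscale \<tau> genH) (cscale n genM)" "f (genK 0) = cscale t (genK 0)"
    "f (genP 0) = cadd (cscale s (genP 0)) (cscale u (genK 0))" "kin_related \<tau> s t u c c'"
proof -
  note One_nat_def [simp del]
  note fD = lie_isoD[OF f, simplified]
  have gS: "genH \<in> S" "genK 0 \<in> S" "genP 0 \<in> S" "czero \<in> S"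
    using S by (auto simp: amb_space_closed kin_space_closed)
  have cl: "cscale r x \<in> S" "cadd x y \<in> S" if "x \<in> S" "y \<in> S" for r x y
    using S that by (auto simp: amb_space_closed kin_space_closed)
  have fS: "f x \<in> amb_space 1" if "x \<in> S" for x
    using fD(1)[OF that] S by (auto simp: kin_space_def)
  have inj: "inj_on f S" using fD(5) by (simp add: bij_betw_def)
  note f0 = lie_iso_czero[OF f gS(4)]
  define \<tau> s t u where "\<tau> = time (f genH)" and "s = mom (f (genP 0)) 0" and "t = boost (f (genK 0)) 0"
    and "u = boost (f (genP 0)) 0"
  \<comment> \<open>In dimension 1 the only index is 0, so each vector component is a single
    number.\<close>
  have sup: "mom (f x) = (\<lambda>i. of_bool (i = 0) * mom (f x) 0)" "boost (f x) = (\<lambda>i. of_bool (i = 0) * boost (f x) 0)"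
    if "x \<in> S" for x
    using amb_spaceD(1,2)[OF fS[OF that]] by (auto simp: fun_eq_iff)
  have fH: "f genH = cadd (cscale \<tau> genH) (cscale n genM)"
    using H by (simp add: coords_eq_iff \<tau>_def)
  have fK: "f (genK 0) = cscale t (genK 0)"
    using K sup(2)[OF gS(2)] by (simp add: coords_eq_iff t_def mult.commute)
  have fP: "f (genP 0) = cadd (cscale s (genP 0)) (cscale u (genK 0))"
    using P sup[OF gS(3)] by (simp add: coords_eq_iff s_def u_def mult.commute)
  have t: "t \<noteq> 0"
  proof
    assume "t = 0"
    then have "f (genK 0) = f czero" by (simp add: fK f0 coords_eq_iff)
    then have "genK 0 = czero" using inj gS by (auto dest: inj_onD)
    then have "boost (genK 0) 0 = boost czero 0" by simp
    then show False by simp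
  qed
  \<comment> \<open>Otherwise \<open>P\<close> and \<open>K\<close> would both be mapped to
    multiples of \<open>K\<close>, against injectivity.\<close>
  have s: "s \<noteq> 0"
  proof
    assume "s = 0"
    then have "f (genP 0) = f (cscale (u / t) (genK 0))" using t by (simp add: fP fD(3)[OF gS(2)] fK coords_eq_iff)
    then have "genP 0 = cscale (u / t) (genK 0)" using inj gS cl by (auto dest: inj_onD)
    then have "mom (genP 0) 0 = mom (cscale (u / t) (genK 0)) 0" by simp
    then show False by simp
  qed
  note ev = amb_bracket_sel dot_def matvec_def matcomm_def wedge_def
  have hom: "f (amb_bracket c 1 x y) = amb_bracket c' 1 (f x) (f y)" if "x \<in> S" "y \<in> S" for x y
    using fD(4)[OF that] br that fD(1) by simp
  have lin: "f (cadd (cscale a x) (cscale b y)) = cadd (cscale a (f x)) (cscale b (f y))"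
    if "x \<in> S" "y \<in> S" for a b x y
    using that cl fD(2,3) by simp
  have KH: "cadd (cscale (KH_P c) (f (genP 0))) (cscale (KH_K c) (f (genK 0))) = amb_bracket c' 1 (f (genK 0)) (f genH)"
    using hom[OF gS(2,1)] by (simp add: amb_commutators(1)[of 0 1 0] lin gS)
  have HP: "cadd (cscale (HP_P c) (f (genP 0))) (cscale (HP_K c) (f (genK 0))) = amb_bracket c' 1 (f genH) (f (genP 0))"
    using hom[OF gS(1,3)] by (simp add: amb_commutators(2)[of 0 1 0] lin gS)
  have "amb_bracket c 1 (genK 0) (genP 0) = cadd (cscale (KP_H c) genH) (cscale (KP_M c) genM)"
    by (simp add: amb_commutators(6)[of 0 1 0] coords_eq_iff genJ_def)
  then have "cadd (cscale (KP_H c) (f genH)) (f (cscale (KP_M c) genM)) = amb_bracket c' 1 (f (genK 0)) (f (genP 0))"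
    using hom[OF gS(2,3)] M cl gS fD(2,3) by simp
  \<comment> \<open>Comparing times discards the image of the mass term, of which only membership in
    \<open>span_M\<close> is known.\<close>
  from arg_cong[OF this, of time] have 1: "KP_H c * \<tau> = KP_H c' * t * s"
    using M(2) by (simp add: fH fK fP ev c' span_M_iff)
  have "s * KH_P c = KH_P c' * t * \<tau>"
    using arg_cong[OF KH, of "\<lambda>x. mom x 0"] by (simp add: fH fK fP ev c' mult.commute)
  moreover have "t * KH_K c + u * KH_P c = KH_K c' * t * \<tau>"
    using arg_cong[OF KH, of "\<lambda>x. boost x 0"] by (simp add: fH fK fP ev c' algebra_simps)
  moreover have "s * HP_P c = HP_P c' * \<tau> * s - KH_P c' * \<tau> * u"
    using arg_cong[OF HP, of "\<lambda>x. mom x 0"] by (simp add: fH fK fP ev c' algebra_simps)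
  moreover have "t * HP_K c + u * HP_P c = HP_K c' * \<tau> * s - KH_K c' * \<tau> * u"
    using arg_cong[OF HP, of "\<lambda>x. boost x 0"] by (simp add: fH fK fP ev c' algebra_simps)
  ultimately have "kin_related \<tau> s t u c c'" using 1 by (simp add: kin_related_def)
  with that[OF _ s t fH fK fP] Hz show thesis by (simp add: \<tau>_def)
qed

lemma kin_related_trivial_lift [simp]:
  "kin_related \<tau> s t u (trivial_lift k) c' = kin_related \<tau> s t u k c'"
  "kin_related \<tau> s t u c (trivial_lift k) = kin_related \<tau> s t u c k"
  by (simp_all add: kin_related_def)

lemma klein_isomorphic_kin_params:
  assumes "klein_isomorphic (kin k 1) (kin k' 1)"
  obtains \<tau> s t u where "\<tau> \<noteq> 0" "s \<noteq> 0" "t \<noteq> 0" "kin_related \<tau> s t u k k'"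
proof -
  obtain f where f: "f \<in> klein_iso (kin k 1) (kin k' 1)"
    using assms by (auto simp: klein_isomorphic_def)
  then have fl: "f \<in> lie_iso (coord_lie (kin_space 1) (kin_bracket k 1)) (coord_lie (kin_space 1) (kin_bracket k' 1))"
    and im: "f ` isotropy (kin k 1) = isotropy (kin k' 1)" "f ` scalars (kin k 1) = scalars (kin k' 1)"
      "f ` vectors (kin k 1) = vectors (kin k' 1)"
    by (simp_all add: klein_iso_def)
  note One_nat_def [simp del]
  note fD = lie_isoD[OF fl, simplified]
  note f0 = lie_iso_czero[OF fl kin_space_closed(1)]
  have H: "f genH \<in> scalars (kin k' 1)" by (subst im(2)[symmetric]) (simp add: kin_sel)
  \<comment> \<open>\<open>K\<close> is recovered as the intersection of the isotropy with the
    vectors; \<open>P\<close> is constrained by the vectors alone, which leaves the shear.\<close>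
  have K: "f (genK 0) \<in> isotropy (kin k' 1)" "f (genK 0) \<in> vectors (kin k' 1)"
    by (subst im(1)[symmetric] im(3)[symmetric]; simp add: kin_sel)+
  have P: "f (genP 0) \<in> vectors (kin k' 1)" by (subst im(3)[symmetric]) (simp add: kin_sel)
  have Hz: "time (f genH) \<noteq> 0"
  proof
    assume "time (f genH) = 0"
    then have "f genH = f czero" using H by (simp add: f0 kin_sel kin_space_def coords_eq_iff)
    then have "genH = czero" using fD(5) kin_space_closed(1) gens_in_kin_space(1) by (auto simp: bij_betw_def dest: inj_onD)
    then show False by (simp add: coords_eq_iff)
  qed
  obtain \<tau> s t u where "\<tau> \<noteq> 0" "s \<noteq> 0" "t \<noteq> 0" "kin_related \<tau> s t u (trivial_lift k) (trivial_lift k')"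
    by (rule lie_iso_params[OF _ fl kin_bracket_eq kin_bracket_eq, where n = 0])
       (use H K P Hz in \<open>auto simp: cscale_0 f0 amb_space_closed kin_space_closed kin_sel kin_space_def span_M_iff\<close>)
  then show thesis using that by simp
qed

text \<open>The converse of \<open>triplet_isomorphic_rescale\<close>: dimension 1 alone forces the
  relations that suffice in every dimension.\<close>

lemma triplet_isomorphic_params:
  assumes "triplet_isomorphic (amb c 1, span_M) (amb c' 1, span_M)"
    and c: "admissible c" "admissible c'"
  obtains \<mu> n \<tau> s t u where "\<mu> \<noteq> 0" "\<tau> \<noteq> 0" "s \<noteq> 0" "t \<noteq> 0" "kin_related \<tau> s t u c c'"
    "HM_M c = HM_M c' * \<tau>" "\<mu> * KP_M c + n * KP_H c = KP_M c' * t * s"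
proof -
  obtain f where f: "f \<in> klein_iso (amb c 1) (amb c' 1)" and fM: "f ` span_M = span_M"
    using assms by (auto simp: triplet_isomorphic_def)
  then have fl: "f \<in> lie_iso (coord_lie (amb_space 1) (amb_bracket c 1)) (coord_lie (amb_space 1) (amb_bracket c' 1))"
    and im: "f ` isotropy (amb c 1) = isotropy (amb c' 1)" "f ` scalars (amb c 1) = scalars (amb c' 1)"
      "f ` vectors (amb c 1) = vectors (amb c' 1)"
    by (simp_all add: klein_iso_def)
  note One_nat_def [simp del]
  note fD = lie_isoD[OF fl, simplified]
  have red: "HM_H c = 0" "MP_P c = 0" "MP_K c = 0" "MK_P c = 0" "MK_K c = 0"
    "HM_H c' = 0" "MP_P c' = 0" "MP_K c' = 0" "MK_P c' = 0" "MK_K c' = 0"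
    using c by (auto simp: admissible_def)
  have inj: "inj_on f (amb_space 1)" using fD(5) by (simp add: bij_betw_def)
  have H: "f genH \<in> scalars (amb c' 1)" by (subst im(2)[symmetric]) (simp add: amb_sel)
  have K: "f (genK 0) \<in> isotropy (amb c' 1)" "f (genK 0) \<in> vectors (amb c' 1)"
    by (subst im(1)[symmetric] im(3)[symmetric]; simp add: amb_sel isotropy_amb)+
  have P: "f (genP 0) \<in> vectors (amb c' 1)" by (subst im(3)[symmetric]) (simp add: amb_sel)
  have Mx: "f x \<in> span_M" if "x \<in> span_M" for x using fM that by blast
  have M: "cscale r genM \<in> span_M" for r by (simp add: span_M_iff)
  obtain \<mu> where \<mu>: "f genM = cscale \<mu> genM"
  proof -
    have "f genM \<in> span_M" by (rule Mx) (simp add: span_M_iff)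
    then show ?thesis using that by (auto simp: span_M_def)
  qed
  \<comment> \<open>A scalar without time component lies in \<open>span_M\<close>, which is the
    image of \<open>span_M\<close>; injectivity would then put \<open>H\<close> there.\<close>
  have Hz: "time (f genH) \<noteq> 0"
  proof
    assume "time (f genH) = 0"
    then have "f genH \<in> f ` span_M" using H by (simp add: fM span_M_iff amb_sel)
    then have "genH \<in> span_M" using inj span_M_subset[of 1] by (auto dest!: inj_onD)
    then show False by (simp add: span_M_iff)
  qed
  have \<mu>0: "\<mu> \<noteq> 0"
  proof
    assume "\<mu> = 0"
    then have "f genM = czero" using \<mu> by (simp add: cscale_0)
    also have "czero = cscale 0 (f genM)" by (simp add: cscale_0)
    also have "\<dots> = f (cscale 0 genM)" using fD(3) by simp
    finally have "genM = cscale 0 genM" using inj amb_space_closed(3)[of genM 1] by (auto dest!: inj_onD)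
    then show False by (simp add: coords_eq_iff)
  qed
  obtain \<tau> s t u where p: "\<tau> \<noteq> 0" "s \<noteq> 0" "t \<noteq> 0"
    "f genH = cadd (cscale \<tau> genH) (cscale (mass (f genH)) genM)" "f (genK 0) = cscale t (genK 0)"
    "f (genP 0) = cadd (cscale s (genP 0)) (cscale u (genK 0))" "kin_related \<tau> s t u c c'"
  proof (rule lie_iso_params[OF _ fl refl refl red(6-10) _ Mx[OF M] _ _ _ refl _ _ _ _ _ _ _ Hz])
    show "cscale (KP_M c) genM \<in> amb_space 1" by (simp add: amb_space_closed)
  qed (use H K P in \<open>simp_all add: amb_sel isotropy_amb\<close>)
  define n where "n = mass (f genH)"
  note fv = p(4)[folded n_def] p(5,6)
  have "amb_bracket c 1 genH genM = cscale (HM_M c) genM"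
    by (simp add: coords_eq_iff amb_bracket_sel red)
  then have "cscale (HM_M c) (f genM) = amb_bracket c' 1 (f genH) (f genM)"
    using fD(4)[of genH genM] fD(3) by simp
  from arg_cong[OF this, of mass] have 1: "HM_M c = HM_M c' * \<tau>"
    using \<mu>0 by (simp add: fv \<mu> amb_bracket_sel red)
  have "amb_bracket c 1 (genK 0) (genP 0) = cadd (cscale (KP_M c) genM) (cscale (KP_H c) genH)"
    by (simp add: amb_commutators(6)[of 0 1 0] coords_eq_iff genJ_def)
  then have "cadd (cscale (KP_M c) (f genM)) (cscale (KP_H c) (f genH)) = amb_bracket c' 1 (f (genK 0)) (f (genP 0))"
    using fD(4)[of "genK 0" "genP 0"] fD(2,3) amb_space_closed(3) by simp
  from arg_cong[OF this, of mass] have "\<mu> * KP_M c + n * KP_H c = KP_M c' * t * s"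
    by (simp add: fv \<mu> amb_bracket_sel red dot_def algebra_simps)
  with that \<mu>0 p(1-3,7) 1 show thesis by blast
qed

section \<open>Classification of the lifts\<close>

text \<open>Admissibility yields the Jacobi identity and the hypothesis on \<open>[K, P]\<close> and
  \<open>[K, H]\<close> yields effectiveness; the quotient inherits both from
  \<open>kin\<close>.\<close>

lemma admits_liftI:
  assumes c: "admissible c" and h: "KP_H c \<noteq> 0 \<or> KH_P c \<noteq> 0"
  shows "admits_lift (kin_coeffs.truncate c) c"
proof -
  let ?k = "kin_coeffs.truncate c"
  have red: "HM_H c = 0" "MP_P c = 0" "MP_K c = 0" "MK_P c = 0" "MK_K c = 0"
    and k: "admissible (trivial_lift ?k)" "KP_H ?k \<noteq> 0 \<or> KH_P ?k \<noteq> 0"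
    using c h by (auto simp: admissible_def kin_coeffs.truncate_def)
  note iso = fibre_klein_iso[OF red]
  have "klein_pair (klein_quotient (amb c d) span_M)" "effective (klein_quotient (amb c d) span_M)" for d
  proof -
    have "\<zero>\<^bsub>lie (klein_quotient (amb c d) span_M)\<^esub> = fibre \<zero>\<^bsub>lie (kin ?k d)\<^esub>"
      by (auto simp: klein_quotient_sel fibre_def span_M_iff)
    then show "klein_pair (klein_quotient (amb c d) span_M)" "effective (klein_quotient (amb c d) span_M)"
      using klein_pair_effective_transport[OF iso[of d] klein_pair_kin[OF k(1)] effective_kin[OF k(2)]] by auto
  qed
  moreover have "lie_ideal span_M (lie (amb c d))" for d
  proof -
    have "submodule span_M real_ring (lie (amb c d))"
      unfolding lie_amb
      by (rule submoduleI_coord_lie[OF amb_space_closed span_M_subset]) (auto simp: span_M_iff)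
    moreover have "amb_bracket c d x y \<in> span_M" if "y \<in> span_M" for x y
      using that by (simp add: span_M_iff amb_bracket_sel red)
    ultimately show ?thesis by (simp add: lie_ideal_def)
  qed
  moreover have "klein_isomorphic (kin ?k d) (klein_quotient (amb c d) span_M)" for d
    using iso by (auto simp: klein_isomorphic_def)
  ultimately show ?thesis
    unfolding admits_lift_def universal_projectable_def
    using klein_pair_amb[OF c] effective_amb[OF h] by blast
qed

text \<open>Dimension 2 supplies admissibility and dimension 1 the numbers, the latter from the
  composite of \<open>kin k\<close> to the quotient with the inverse of
  \<open>fibre\<close>.\<close>

lemma admits_lift_params:
  assumes "admits_lift k c"
  obtains \<tau> s t u where "\<tau> \<noteq> 0" "s \<noteq> 0" "t \<noteq> 0" "kin_related \<tau> s t u k c" "admissible c"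
proof -
  have "klein_pair (amb c 2)" "lie_ideal span_M (lie (amb c 2))"
    using assms by (auto simp: admits_lift_def universal_projectable_def)
  then have c: "admissible c" by (auto intro: admissibleI simp: klein_pair_def simp del: lie_amb)
  let ?k = "kin_coeffs.truncate c"
  have red: "HM_H c = 0" "MP_P c = 0" "MP_K c = 0" "MK_P c = 0" "MK_K c = 0"
    and k: "admissible (trivial_lift ?k)"
    using c by (auto simp: admissible_def kin_coeffs.truncate_def)
  obtain f where f: "f \<in> klein_iso (kin k 1) (klein_quotient (amb c 1) span_M)"
    using assms by (auto simp: admits_lift_def klein_isomorphic_def)
  have "klein_isomorphic (kin k 1) (kin ?k 1)"
    using klein_iso_comp[OF f klein_iso_inv[OF fibre_klein_iso[OF red] klein_wf_kin[OF k]]]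
    by (auto simp: klein_isomorphic_def)
  then obtain \<tau> s t u where "\<tau> \<noteq> 0" "s \<noteq> 0" "t \<noteq> 0" "kin_related \<tau> s t u k ?k"
    by (rule klein_isomorphic_kin_params)
  moreover have "kin_related \<tau> s t u k ?k = kin_related \<tau> s t u k c"
    by (simp add: kin_related_def kin_coeffs.truncate_def)
  ultimately show thesis using that c by simp
qed

lemma universal_effective_kinematicalI:
  assumes "admissible (trivial_lift k)" "KP_H k \<noteq> 0 \<or> KH_P k \<noteq> 0"
  shows "universal_effective_kinematical k"
  using klein_pair_kin[OF assms(1)] effective_kin[OF assms(2)]
  by (simp add: universal_effective_kinematical_def)

text \<open>The relations run from \<open>c'\<close> to \<open>c\<close>, since a lift provides
  parameters from the normal form to \<open>c\<close>; the resulting isomorphism is then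
  inverted.\<close>

lemma universal_triplet_isomorphicI:
  assumes "\<mu> \<noteq> 0" "\<tau> \<noteq> 0" "s \<noteq> 0" "t \<noteq> 0" "admissible c" "admissible c'" "kin_related \<tau> s t u c' c"
    "HM_M c' = HM_M c * \<tau>" "\<mu> * KP_M c' + n * KP_H c' = KP_M c * t * s"
  shows "universal_triplet_isomorphic c c'"
  unfolding universal_triplet_isomorphic_def
  using triplet_isomorphic_sym[OF triplet_isomorphic_rescale] assms by blast

section \<open>Coefficients of the normal forms\<close>

lemma truncate_lifts:
  "kin_coeffs.truncate (trivial_lift k) = k"
  "kin_coeffs.truncate (bargmannian_lift \<epsilon> \<omega>) = galilean_pair \<epsilon> \<omega>"
  "kin_coeffs.truncate (G_ambient_lift \<epsilon> \<omega> \<mu>) = galilean_pair \<epsilon> \<omega>"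
  by (simp_all add: bargmannian_lift_def G_ambient_lift_def kin_coeffs.truncate_def trivial_lift_def
      kin_coeffs.defs amb_coeffs.defs)

lemma galilean_pair_sel [simp]:
  "KH_P (galilean_pair \<epsilon> \<omega>) = 1" "KH_K (galilean_pair \<epsilon> \<omega>) = 0" "HP_P (galilean_pair \<epsilon> \<omega>) = \<omega>"
  "HP_K (galilean_pair \<epsilon> \<omega>) = \<epsilon>" "KP_H (galilean_pair \<epsilon> \<omega>) = 0" "KP_J (galilean_pair \<epsilon> \<omega>) = 0"
  "KK_J (galilean_pair \<epsilon> \<omega>) = 0" "PP_J (galilean_pair \<epsilon> \<omega>) = 0"
  by (simp_all add: galilean_pair_def kin0_def)

lemma bargmannian_lift_sel [simp]:
  "KH_P (bargmannian_lift \<epsilon> \<omega>) = 1" "KH_K (bargmannian_lift \<epsilon> \<omega>) = 0" "HP_P (bargmannian_lift \<epsilon> \<omega>) = \<omega>"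
  "HP_K (bargmannian_lift \<epsilon> \<omega>) = \<epsilon>" "KP_H (bargmannian_lift \<epsilon> \<omega>) = 0" "KP_J (bargmannian_lift \<epsilon> \<omega>) = 0"
  "KK_J (bargmannian_lift \<epsilon> \<omega>) = 0" "PP_J (bargmannian_lift \<epsilon> \<omega>) = 0"
  "KP_M (bargmannian_lift \<epsilon> \<omega>) = 1" "HM_M (bargmannian_lift \<epsilon> \<omega>) = \<omega>" "HM_H (bargmannian_lift \<epsilon> \<omega>) = 0"
  "MP_P (bargmannian_lift \<epsilon> \<omega>) = 0" "MP_K (bargmannian_lift \<epsilon> \<omega>) = 0" "MK_P (bargmannian_lift \<epsilon> \<omega>) = 0"
  "MK_K (bargmannian_lift \<epsilon> \<omega>) = 0"
  by (simp_all add: bargmannian_lift_def)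

lemma G_ambient_lift_sel [simp]:
  "KH_P (G_ambient_lift \<epsilon> \<omega> \<mu>) = 1" "KH_K (G_ambient_lift \<epsilon> \<omega> \<mu>) = 0" "HP_P (G_ambient_lift \<epsilon> \<omega> \<mu>) = \<omega>"
  "HP_K (G_ambient_lift \<epsilon> \<omega> \<mu>) = \<epsilon>" "KP_H (G_ambient_lift \<epsilon> \<omega> \<mu>) = 0" "KP_J (G_ambient_lift \<epsilon> \<omega> \<mu>) = 0"
  "KK_J (G_ambient_lift \<epsilon> \<omega> \<mu>) = 0" "PP_J (G_ambient_lift \<epsilon> \<omega> \<mu>) = 0"
  "KP_M (G_ambient_lift \<epsilon> \<omega> \<mu>) = 0" "HM_M (G_ambient_lift \<epsilon> \<omega> \<mu>) = \<mu>" "HM_H (G_ambient_lift \<epsilon> \<omega> \<mu>) = 0"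
  "MP_P (G_ambient_lift \<epsilon> \<omega> \<mu>) = 0" "MP_K (G_ambient_lift \<epsilon> \<omega> \<mu>) = 0" "MK_P (G_ambient_lift \<epsilon> \<omega> \<mu>) = 0"
  "MK_K (G_ambient_lift \<epsilon> \<omega> \<mu>) = 0"
  by (simp_all add: G_ambient_lift_def)

lemma admissible_lifts:
  "admissible (trivial_lift (galilean_pair \<epsilon> \<omega>))"
  "admissible (bargmannian_lift \<epsilon> \<omega>)" "admissible (G_ambient_lift \<epsilon> \<omega> \<mu>)"
  by (simp_all add: admissible_def)

lemma non_galilean_pairs:
  assumes "k \<in> carrollian_pairs \<union> riemannian_pairs \<union> lorentzian_pairs"
  shows "KP_H k = 1" "admissible (trivial_lift k)"
  using assms by (auto simp: carrollian_pairs_def riemannian_pairs_def lorentzian_pairs_def kin0_def admissible_def)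

lemma trivial_lift_unique:
  assumes k: "KP_H k \<noteq> 0" "admissible (trivial_lift k)" and l: "admits_lift k c"
  shows "universal_triplet_isomorphic c (trivial_lift k)"
proof -
  obtain \<tau> s t u where nz: "\<tau> \<noteq> 0" "s \<noteq> 0" "t \<noteq> 0" and rel: "kin_related \<tau> s t u k c" and c: "admissible c"
    using l by (rule admits_lift_params)
  then have "KP_H c \<noteq> 0" using k by (auto simp: kin_related_def)
  then have "HM_M c = 0" using c by (auto simp: admissible_def)
  then show ?thesis
    using nz rel c k
    \<comment> \<open>The value of \<open>n\<close> solves the mass relation, whose left side is
      \<open>n * KP_H k\<close> because the trivial lift has no \<open>M\<close> in
      \<open>[K, P]\<close>.\<close>
    by (intro universal_triplet_isomorphicI[of 1 \<tau> s t c _ u "KP_M c * t * s / KP_H k"]) auto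
qed

lemma galilean_lift_params:
  assumes "admits_lift (galilean_pair \<epsilon> \<omega>) c"
  obtains \<tau> s t u where "\<tau> \<noteq> 0" "s \<noteq> 0" "t \<noteq> 0" "kin_related \<tau> s t u (galilean_pair \<epsilon> \<omega>) c"
    "admissible c" "KP_H c = 0" "KH_P c \<noteq> 0"
  using assms
proof (rule admits_lift_params)
  fix \<tau> s t u
  assume *: "\<tau> \<noteq> 0" "s \<noteq> 0" "t \<noteq> 0" "kin_related \<tau> s t u (galilean_pair \<epsilon> \<omega>) c" "admissible c"
  then show thesis by (intro that[OF *]) (auto simp: kin_related_def)
qed

text \<open>The Jacobi identity makes \<open>HM_M c\<close> equal to \<open>HP_P c - KH_K c\<close>,
  the trace of \<open>ad H\<close> on the plane of \<open>K_i\<close> and \<open>P_i\<close>. A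
  trace is insensitive to the change of basis by \<open>s\<close>, \<open>t\<close>,
  \<open>u\<close> and scales with \<open>H\<close>, so \<open>HM_M c * \<tau>\<close> equals the
  trace \<open>\<omega>\<close> of the normal form.\<close>

lemma massive_lift_isomorphic_bargmannian:
  assumes l: "admits_lift (galilean_pair \<epsilon> \<omega>) c" and m: "KP_M c \<noteq> 0"
  shows "universal_triplet_isomorphic c (bargmannian_lift \<epsilon> \<omega>)"
proof -
  obtain \<tau> s t u where nz: "\<tau> \<noteq> 0" "s \<noteq> 0" "t \<noteq> 0" and rel: "kin_related \<tau> s t u (galilean_pair \<epsilon> \<omega>) c"
    and c: "admissible c"
    using l by (rule galilean_lift_params)
  have *: "s = KH_P c * t * \<tau>" "s * \<omega> = HP_P c * \<tau> * s - KH_P c * \<tau> * u" "u = KH_K c * t * \<tau>"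
    using rel by (auto simp: kin_related_def)
  have HM: "HM_M c = HP_P c - KH_K c" using c m by (simp add: admissible_def)
  have "s * (HM_M c * \<tau>) = HP_P c * \<tau> * s - s * KH_K c * \<tau>"
    by (simp add: HM algebra_simps)
  also have "s * KH_K c * \<tau> = KH_P c * \<tau> * u"
    by (simp add: *(1,3))
  also have "HP_P c * \<tau> * s - KH_P c * \<tau> * u = s * \<omega>" using *(2) by simp
  finally have "HM_M c * \<tau> = \<omega>" using nz by simp
  moreover have "kin_related \<tau> s t u (bargmannian_lift \<epsilon> \<omega>) c"
    using rel unfolding kin_related_def bargmannian_lift_sel galilean_pair_sel .
  ultimately show ?thesis
    using nz c m admissible_lifts(2)
    \<comment> \<open>This rescaling of \<open>M\<close> normalises the mass part of
      \<open>[K, P]\<close> to 1; it is invertible because \<open>KP_M c\<close> is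
      non-zero.\<close>
    by (intro universal_triplet_isomorphicI[of "KP_M c * t * s" \<tau> s t c _ u 0]) auto
qed

lemma massless_lift_isomorphic_G_ambient:
  assumes l: "admits_lift (galilean_pair \<epsilon> \<omega>) c" and m: "KP_M c = 0" and p: "(\<epsilon>, \<omega>) \<in> galilean_parameters"
  shows "\<exists>\<mu>\<in>G_ambient_parameters \<epsilon> \<omega>. universal_triplet_isomorphic c (G_ambient_lift \<epsilon> \<omega> \<mu>)"
proof -
  obtain \<tau> s t u where nz: "\<tau> \<noteq> 0" "s \<noteq> 0" "t \<noteq> 0" and rel: "kin_related \<tau> s t u (galilean_pair \<epsilon> \<omega>) c"
    and c: "admissible c" and h: "KP_H c = 0"
    using l by (rule galilean_lift_params)
  \<comment> \<open>Residual freedom: rescaling \<open>H\<close> and \<open>P\<close> together by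
    \<open>\<sigma>\<close> preserves \<open>[K, H] = P\<close> and multiplies
    \<open>\<omega>\<close> by \<open>\<sigma>\<close> and \<open>\<epsilon>\<close> by
    \<open>\<sigma> * \<sigma>\<close>. The assumptions say that both parameters survive; meanwhile
    the coefficient of \<open>[H, M]\<close> is multiplied by \<open>\<sigma>\<close>.\<close>
  have scaled: "universal_triplet_isomorphic c (G_ambient_lift \<epsilon> \<omega> (HM_M c * (\<sigma> * \<tau>)))"
    if "\<sigma> \<noteq> 0" "\<sigma> = 1 \<or> \<omega> = 0" "\<epsilon> = 0 \<or> \<sigma> * \<sigma> = 1" for \<sigma>
  proof (rule universal_triplet_isomorphicI[of 1 "\<sigma> * \<tau>" "\<sigma> * s" t c _ "\<sigma> * u" 0])
    have e: "t * \<epsilon> + u * \<omega> = HP_K c * \<tau> * s - KH_K c * \<tau> * u" "s * \<omega> = HP_P c * \<tau> * s - KH_P c * \<tau> * u"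
      using rel by (auto simp: kin_related_def)
    have "\<sigma> * s * \<omega> = HP_P c * (\<sigma> * \<tau>) * (\<sigma> * s) - KH_P c * (\<sigma> * \<tau>) * (\<sigma> * u)"
    proof -
      have "HP_P c * (\<sigma> * \<tau>) * (\<sigma> * s) - KH_P c * (\<sigma> * \<tau>) * (\<sigma> * u) = \<sigma> * \<sigma> * (s * \<omega>)" unfolding e(2) by (simp add: algebra_simps)
      then show ?thesis using that(2) by auto
    qed
    moreover have "t * \<epsilon> + \<sigma> * u * \<omega> = HP_K c * (\<sigma> * \<tau>) * (\<sigma> * s) - KH_K c * (\<sigma> * \<tau>) * (\<sigma> * u)"
    proof -
      have "HP_K c * (\<sigma> * \<tau>) * (\<sigma> * s) - KH_K c * (\<sigma> * \<tau>) * (\<sigma> * u) = \<sigma> * \<sigma> * (t * \<epsilon> + u * \<omega>)" unfolding e(1) by (simp add: algebra_simps)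
      then show ?thesis using that(2,3) by (auto simp: algebra_simps)
    qed
    ultimately show "kin_related (\<sigma> * \<tau>) (\<sigma> * s) t (\<sigma> * u) (G_ambient_lift \<epsilon> \<omega> (HM_M c * (\<sigma> * \<tau>))) c"
      unfolding kin_related_def G_ambient_lift_sel
      using rel h by (intro conjI) (simp_all add: kin_related_def)
  qed (use that nz c m admissible_lifts(3) in auto)
  show ?thesis
  proof (cases "\<omega> = 0")
    case False
    then show ?thesis using scaled[of 1] by (auto simp: G_ambient_parameters_def)
  next
    case \<omega>: True
    show ?thesis
    proof (cases "\<epsilon> = 0")
      case True
      then show ?thesis
        \<comment> \<open>Without constraint on \<open>\<sigma>\<close>, a non-zero coefficient can
          be normalised to 1.\<close>
        using \<omega> nz scaled[of 1] scaled[of "1 / (HM_M c * \<tau>)"]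
        by (cases "HM_M c = 0") (auto simp: G_ambient_parameters_def)
    next
      case False
      then show ?thesis
        \<comment> \<open>Here only a sign is free, and it makes the coefficient
          non-negative.\<close>
        using \<omega> scaled[of 1] scaled[of "-1"]
        by (cases "HM_M c * \<tau> \<ge> 0") (auto simp: G_ambient_parameters_def)
    qed
  qed
qed

section \<open>Invariant tensors and the two classes of galilean lifts\<close>

lemma isotropy_action_sel:
  assumes "a \<in> isotropy (amb c d)" "v \<in> tangent_space d" "MK_P c = 0"
  shows "mass (isotropy_action c d a v) = KP_M c * dot d (boost a) (mom v)"
    "time (isotropy_action c d a v) = KP_H c * dot d (boost a) (mom v)"
    "mom (isotropy_action c d a v) = (\<lambda>i. matvec d (rot a) (mom v) i + KH_P c * (boost a i * time v))"
  using assms by (simp_all add: isotropy_action_def amb_bracket_sel isotropy_amb tangent_space_def)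

text \<open>Rotations cancel by skew-symmetry. The remaining boost term vanishes on the kernel of
  \<open>\<psi>\<close>; in the bargmannian metric it is compensated by the mass that boosts
  create.\<close>

lemma dot_isotropy_action:
  assumes a: "a \<in> isotropy (amb c d)" and v: "v \<in> tangent_space d" and w: "w \<in> tangent_space d" and c: "MK_P c = 0"
  shows "dot d (mom (isotropy_action c d a v)) (mom w) + dot d (mom v) (mom (isotropy_action c d a w)) =
    KH_P c * (time v * dot d (boost a) (mom w) + time w * dot d (boost a) (mom v))"
proof -
  have a': "a \<in> amb_space d" using a by (simp add: isotropy_amb)
  have "dot d (matvec d (rot a) (mom v)) (mom w) = - dot d (mom v) (matvec d (rot a) (mom w))"
    by (rule dot_matvec_skew[OF amb_spaceD(3)[OF a']])
  then show ?thesis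
    using dot_commute[of d "mom v" "boost a"]
    by (simp add: isotropy_action_sel(3)[OF a v c] isotropy_action_sel(3)[OF a w c] lin_simps algebra_simps)
qed

lemma invariant_xi_psi_gammaI:
  assumes "KP_H c = 0" "HM_H c = 0" "MK_P c = 0"
  shows "invariant_xi_psi_gamma c d"
  unfolding invariant_xi_psi_gamma_def
proof (intro conjI)
  show "invariant_vector c d genM"
    using assms by (auto simp: invariant_vector_def isotropy_action_def amb_bracket_sel isotropy_amb coords_eq_iff)
  show "invariant_covector c d (\<lambda>v. - time v)"
    using assms by (auto simp: invariant_covector_def isotropy_action_sel)
  show "invariant_form c d {v \<in> tangent_space d. - time v = 0} (\<lambda>v w. dot d (mom v) (mom w))"
    using assms by (auto simp: invariant_form_def dot_isotropy_action)
qed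

lemma bargmannian_bargmannian_lift: "bargmannian (bargmannian_lift \<epsilon> \<omega>)"
  unfolding bargmannian_def
proof (intro allI impI conjI)
  fix d :: nat
  show "invariant_xi_psi_gamma (bargmannian_lift \<epsilon> \<omega>) d"
    by (rule invariant_xi_psi_gammaI) simp_all
  show "invariant_form (bargmannian_lift \<epsilon> \<omega>) d (tangent_space d)
     (\<lambda>v w. - mass v * time w - time v * mass w + dot d (mom v) (mom w))"
    unfolding invariant_form_def
  proof (intro ballI)
    fix a v w
    assume "a \<in> isotropy (amb (bargmannian_lift \<epsilon> \<omega>) d)" "v \<in> tangent_space d" "w \<in> tangent_space d"
    note 1 = isotropy_action_sel(1,2)[OF this(1,2)] isotropy_action_sel(1,2)[OF this(1,3)] dot_isotropy_action[OF this]
    show "- mass (isotropy_action (bargmannian_lift \<epsilon> \<omega>) d a v) * time w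
          - time (isotropy_action (bargmannian_lift \<epsilon> \<omega>) d a v) * mass w
          + dot d (mom (isotropy_action (bargmannian_lift \<epsilon> \<omega>) d a v)) (mom w)
        + (- mass v * time (isotropy_action (bargmannian_lift \<epsilon> \<omega>) d a w)
          - time v * mass (isotropy_action (bargmannian_lift \<epsilon> \<omega>) d a w)
          + dot d (mom v) (mom (isotropy_action (bargmannian_lift \<epsilon> \<omega>) d a w))) = 0"
      using 1 by (simp add: algebra_simps)
  qed
qed

lemma G_ambient_G_ambient_lift: "G_ambient (G_ambient_lift \<epsilon> \<omega> \<mu>)"
  by (auto simp: G_ambient_def invariant_xi_psi_gammaI invariant_covector_def isotropy_action_sel)

text \<open>Invariance of the metric under \<open>K_0\<close>, tested on \<open>P_0\<close> and
  \<open>H\<close>, reads \<open>- KP_M c + KH_P c = 0\<close>. For lifts of a galilean pair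
  \<open>KH_P c\<close> is non-zero, so bargmannian lifts are massive.\<close>

lemma bargmannian_KP_M:
  assumes "bargmannian c" "KP_H c = 0"
  shows "KP_M c = KH_P c"
proof -
  have "invariant_form c 1 (tangent_space 1)
     (\<lambda>v w. - mass v * time w - time v * mass w + dot 1 (mom v) (mom w))"
    using assms(1) by (auto simp: bargmannian_def)
  moreover have "genK 0 \<in> isotropy (amb c 1)" "genP 0 \<in> tangent_space 1" "genH \<in> tangent_space 1"
    by (simp_all add: isotropy_amb tangent_space_def)
  ultimately have "(\<lambda>v w. - mass v * time w - time v * mass w + dot 1 (mom v) (mom w))
       (isotropy_action c 1 (genK 0) (genP 0)) genH +
     (\<lambda>v w. - mass v * time w - time v * mass w + dot 1 (mom v) (mom w))
       (genP 0) (isotropy_action c 1 (genK 0) genH) = 0"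
    unfolding invariant_form_def by blast
  then show ?thesis by (simp add: isotropy_action_def amb_bracket_sel dot_def assms(2))
qed

lemma G_ambient_KP_M:
  assumes "G_ambient c"
  shows "KP_M c = 0"
proof -
  have "invariant_covector c 1 mass" using assms by (auto simp: G_ambient_def)
  moreover have "genK 0 \<in> isotropy (amb c 1)" "genP 0 \<in> tangent_space 1"
    by (simp_all add: isotropy_amb tangent_space_def)
  ultimately have "mass (isotropy_action c 1 (genK 0) (genP 0)) = 0"
    unfolding invariant_covector_def by blast
  then show ?thesis by (simp add: isotropy_action_def amb_bracket_sel dot_def)
qed

text \<open>As \<open>KP_H\<close> vanishes on both sides, the mass relation would force the scale
  factor of \<open>M\<close> to be 0.\<close>

lemma bargmannian_not_isomorphic_G_ambient:
  "\<not> universal_triplet_isomorphic (bargmannian_lift \<epsilon> \<omega>) (G_ambient_lift \<epsilon> \<omega> \<mu>)"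
proof
  assume "universal_triplet_isomorphic (bargmannian_lift \<epsilon> \<omega>) (G_ambient_lift \<epsilon> \<omega> \<mu>)"
  then have "triplet_isomorphic (amb (bargmannian_lift \<epsilon> \<omega>) 1, span_M) (amb (G_ambient_lift \<epsilon> \<omega> \<mu>) 1, span_M)"
    by (simp add: universal_triplet_isomorphic_def)
  then show False
    by (rule triplet_isomorphic_params) (simp_all add: admissible_lifts)
qed

text \<open>The relations leave only the freedom \<open>\<sigma>\<close> of the previous
  normalisation, here \<open>\<tau>\<close>, so each parameter set meets every orbit of it
  once.\<close>

lemma G_ambient_lifts_not_isomorphic:
  assumes p: "(\<epsilon>, \<omega>) \<in> galilean_parameters"
    and \<mu>: "\<mu> \<in> G_ambient_parameters \<epsilon> \<omega>" "\<nu> \<in> G_ambient_parameters \<epsilon> \<omega>"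
    and iso: "universal_triplet_isomorphic (G_ambient_lift \<epsilon> \<omega> \<mu>) (G_ambient_lift \<epsilon> \<omega> \<nu>)"
  shows "\<mu> = \<nu>"
proof -
  have "triplet_isomorphic (amb (G_ambient_lift \<epsilon> \<omega> \<mu>) 1, span_M) (amb (G_ambient_lift \<epsilon> \<omega> \<nu>) 1, span_M)"
    using iso by (simp add: universal_triplet_isomorphic_def)
  then obtain \<tau> s t u where nz: "\<tau> \<noteq> 0" "s \<noteq> 0" "t \<noteq> 0"
    and rel: "kin_related \<tau> s t u (G_ambient_lift \<epsilon> \<omega> \<mu>) (G_ambient_lift \<epsilon> \<omega> \<nu>)" and 1: "\<mu> = \<nu> * \<tau>"
    by (rule triplet_isomorphic_params) (simp_all add: admissible_lifts)
  have e: "s = t * \<tau>" "u = 0" "s * \<omega> = \<omega> * \<tau> * s" "t * \<epsilon> = \<epsilon> * \<tau> * s"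
    using rel by (auto simp: kin_related_def)
  have \<omega>: "\<omega> = 0 \<or> \<tau> = 1" using e(3) nz by auto
  have "t * \<epsilon> = t * (\<epsilon> * \<tau> * \<tau>)" using e(1,4) by (simp add: algebra_simps)
  then have \<epsilon>: "\<epsilon> = 0 \<or> \<tau> * \<tau> = 1" using nz by auto
  \<comment> \<open>In the second case \<open>\<mu>\<close> and \<open>\<nu>\<close> lie in
    \<open>{0, 1}\<close> and vanish together; in the third they are non-negative with
    \<open>\<mu> = - \<nu>\<close>, hence both 0.\<close>
  consider "\<tau> = 1" | "\<omega> = 0" "\<epsilon> = 0" | "\<omega> = 0" "\<epsilon> \<noteq> 0" "\<tau> = -1"
    using \<omega> \<epsilon> square_eq_1_iff[of \<tau>] by auto
  then show ?thesis
    using 1 nz \<mu> by cases (auto simp: G_ambient_parameters_def)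
qed

theorem mainTheorem2:
  shows
    "(\<forall>k \<in> carrollian_pairs \<union> riemannian_pairs \<union> lorentzian_pairs.
        universal_effective_kinematical k \<and>
        admits_lift k (trivial_lift k) \<and>
        (\<forall>c. admits_lift k c \<longrightarrow> universal_triplet_isomorphic c (trivial_lift k)))
     \<and>
     (\<forall>(\<epsilon>, \<omega>) \<in> galilean_parameters.
        universal_effective_kinematical (galilean_pair \<epsilon> \<omega>) \<and>
        admits_lift (galilean_pair \<epsilon> \<omega>) (bargmannian_lift \<epsilon> \<omega>) \<and>
        bargmannian (bargmannian_lift \<epsilon> \<omega>) \<and>
        (\<forall>\<mu> \<in> G_ambient_parameters \<epsilon> \<omega>.
           admits_lift (galilean_pair \<epsilon> \<omega>) (G_ambient_lift \<epsilon> \<omega> \<mu>) \<and>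
           G_ambient (G_ambient_lift \<epsilon> \<omega> \<mu>)) \<and>
        (\<forall>c. admits_lift (galilean_pair \<epsilon> \<omega>) c \<longrightarrow>
           universal_triplet_isomorphic c (bargmannian_lift \<epsilon> \<omega>) \<or>
           (\<exists>\<mu> \<in> G_ambient_parameters \<epsilon> \<omega>.
              universal_triplet_isomorphic c (G_ambient_lift \<epsilon> \<omega> \<mu>))) \<and>
        (\<forall>c. admits_lift (galilean_pair \<epsilon> \<omega>) c \<and> bargmannian c \<longrightarrow>
           universal_triplet_isomorphic c (bargmannian_lift \<epsilon> \<omega>)) \<and>
        (\<forall>c. admits_lift (galilean_pair \<epsilon> \<omega>) c \<and> G_ambient c \<longrightarrow>
           (\<exists>\<mu> \<in> G_ambient_parameters \<epsilon> \<omega>.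
              universal_triplet_isomorphic c (G_ambient_lift \<epsilon> \<omega> \<mu>))) \<and>
        (\<forall>\<mu> \<in> G_ambient_parameters \<epsilon> \<omega>.
           \<not> universal_triplet_isomorphic (bargmannian_lift \<epsilon> \<omega>) (G_ambient_lift \<epsilon> \<omega> \<mu>)) \<and>
        (\<forall>\<mu> \<in> G_ambient_parameters \<epsilon> \<omega>. \<forall>\<nu> \<in> G_ambient_parameters \<epsilon> \<omega>.
           \<mu> \<noteq> \<nu> \<longrightarrow>
           \<not> universal_triplet_isomorphic (G_ambient_lift \<epsilon> \<omega> \<mu>) (G_ambient_lift \<epsilon> \<omega> \<nu>)))"
proof (intro conjI ballI, goal_cases)
  case (1 k)
  then show ?case
    using non_galilean_pairs[OF 1] by (intro universal_effective_kinematicalI) auto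
next
  case (2 k)
  then show ?case
    using non_galilean_pairs[OF 2] admits_liftI[of "trivial_lift k"] by (simp add: truncate_lifts)
next
  case (3 k)
  then show ?case
    using non_galilean_pairs[OF 3] trivial_lift_unique[of k] by simp
next
  case (4 x)
  obtain \<epsilon> \<omega> where x: "x = (\<epsilon>, \<omega>)" by force
  let ?k = "galilean_pair \<epsilon> \<omega>"
  have p: "(\<epsilon>, \<omega>) \<in> galilean_parameters" using 4 x by simp
  have "universal_effective_kinematical ?k"
    by (intro universal_effective_kinematicalI admissible_lifts) simp
  moreover have "admits_lift ?k (bargmannian_lift \<epsilon> \<omega>)"
    using admits_liftI[OF admissible_lifts(2)[of \<epsilon> \<omega>]] by (simp add: truncate_lifts)
  moreover have "admits_lift ?k (G_ambient_lift \<epsilon> \<omega> \<mu>)" for \<mu>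
    using admits_liftI[OF admissible_lifts(3)[of \<epsilon> \<omega> \<mu>]] by (simp add: truncate_lifts)
  moreover have "universal_triplet_isomorphic c (bargmannian_lift \<epsilon> \<omega>)"
    if "admits_lift ?k c" "bargmannian c" for c
  proof (rule massive_lift_isomorphic_bargmannian[OF that(1)])
    have "KP_H c = 0" "KH_P c \<noteq> 0"
      using that(1) by (blast elim: galilean_lift_params)+
    then show "KP_M c \<noteq> 0" using bargmannian_KP_M[OF that(2)] by simp
  qed
  moreover have "\<exists>\<mu>\<in>G_ambient_parameters \<epsilon> \<omega>. universal_triplet_isomorphic c (G_ambient_lift \<epsilon> \<omega> \<mu>)"
    if "admits_lift ?k c" "G_ambient c" for c
    by (rule massless_lift_isomorphic_G_ambient[OF that(1) G_ambient_KP_M[OF that(2)] p])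
  \<comment> \<open>The dichotomy is whether \<open>KP_M c\<close> vanishes.\<close>
  moreover have "universal_triplet_isomorphic c (bargmannian_lift \<epsilon> \<omega>) \<or>
      (\<exists>\<mu> \<in> G_ambient_parameters \<epsilon> \<omega>. universal_triplet_isomorphic c (G_ambient_lift \<epsilon> \<omega> \<mu>))"
    if "admits_lift ?k c" for c
    using massive_lift_isomorphic_bargmannian[OF that] massless_lift_isomorphic_G_ambient[OF that _ p] by blast
  ultimately show ?case
    unfolding x
    using bargmannian_bargmannian_lift G_ambient_G_ambient_lift bargmannian_not_isomorphic_G_ambient
      G_ambient_lifts_not_isomorphic[OF p] by blast
qed

end
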